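(* There exists a unique stationary distribution $\pi$ for the Elo process $(X_t)_{t\in\mathbb{N}}$ on $\mathcal{Z}_N$, and it satisfies: 1. $\mathbb{E}[\|X\|^pe^{\theta_0\|X\|}]<\infty$ when $X\sim\pi$, for all $p\ge0$, where $\theta_0>0$ is the drift constant described in the context. 2. $\lim_{t\to\infty}\mathcal{L}(X_t)=\pi$ weakly (for any random initial condition $X_0\in\mathcal{Z}_N$). 3. If $\mathbb{E}[\|X_0\|^p]<\infty$ for some $p\ge1$, then $\lim_{t\to\infty}W_p(\mathcal{L}(X_t),\pi)=0$.
   Context: Notation: $\mathbb{N}=\{0,1,2,\dots\}$; $N\ge 2$ is an integer (number of players); $\|\cdot\|$ is the Euclidean norm on $\mathbb{R}^N$; $x^i$ is the $i$-th coordinate of $x$; $e_i$ is the $i$-th canonical vector; $\mathcal{Z}_N=\{x\in\mathbb{R}^N:\sum_{i=1}^N x^i=0\}$; $\mathcal{L}(\cdot)$ denotes the law of a random element. For $p\ge1$, $W_p(\mu,\nu)=\inf(\mathbb{E}[\|Y-Z\|^p])^{1/p}$ over all couplings $(Y,Z)$ with $Y\sim\mu$, $Z\sim\nu$. Standing assumptions. (i) $\rho=(\rho^1,\dots,\rho^N)\in\mathcal{Z}_N$ is a fixed vector (true skills). (ii) $b:\mathbb{R}\to(-1,1)$ is odd, strictly increasing and $L$-Lipschitz, and for every $M>0$, $\ell_M:=\inf_{-M\le v<u\le M}\frac{b(u)-b(v)}{u-v}>0$. (iii) For every distinct $i,j\in\{1,\dots,N\}$, $S^{ij}$ is a random variable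 with values in $[-1,1]$, $\mathbb{E}[S^{ij}]=b(\rho^i-\rho^j)$ and $S^{ji}=-S^{ij}$. (iv) $K>0$ is a constant with $KL<1$. (v) For every distinct $i,j$ and every $\epsilon>0$, $\mathbb{P}(S^{ij}<-1+\epsilon)>0$ and $\mathbb{P}(S^{ij}>1-\epsilon)>0$. Elo process: the Markov chain $(X_t)_{t\in\mathbb{N}}$ on $\mathcal{Z}_N$ started from a random vector $X_0\in\mathcal{Z}_N$ with the following dynamics: at step $t$, an ordered pair $(I_t,J_t)$ of distinct indices in $\{1,\dots,N\}$ is chosen uniformly at random (independently of the past); given $I_t=i,J_t=j$, an independent copy $S_t^{ij}$ of $S^{ij}$ is sampled; and $X_{t+1}=X_t+K\{S_t^{ij}-b(X_t^i-X_t^j)\}(e_i-e_j)$. $\mathbb{E}_x$ denotes expectation conditional on $X_0=x$. Drift constant: $\theta_0>0$ denotes a constant with the following property (such a constant exists): for any $\theta\in(0,\theta_0]$ there exist $\lambda\in(0,1)$, $R_1>0$ and $c>0$ (depending on $\theta$) such that for all $x\in\mathcal{Z}_N$, $\mathbb{E}_x[V_\theta(X_1)]\le\lambda V_\theta(x)+c\,\mathbf{1}_{\|x\|\le R_1}$, where $V_\theta(x)=e^{\theta\|x\|}$. *)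

theory Defs
  imports "HOL-Probability.Probability"
begin

definition zero_sum :: "(real ^ 'n) set" where
  "zero_sum = {x. (\<Sum>i\<in>UNIV. x $ i) = 0}"

text \<open>
  Players are the elements of a finite type. The scores \<open>S i j\<close> live on an auxiliary probability
  space \<open>P\<close>; only their laws enter the chain, which may live on a different space.
  \<open>S i i\<close> is irrelevant.
\<close>

locale elo_model = prob_space P
  for P :: "'s measure"
    and S :: "'n::finite \<Rightarrow> 'n \<Rightarrow> 's \<Rightarrow> real"
    and \<rho> :: "real ^ 'n"
    and b :: "real \<Rightarrow> real"
    and L K :: real +
  assumes two_players: "CARD('n) \<ge> 2"
    and rho_zero_sum: "\<rho> \<in> zero_sum"
    and b_range: "\<And>u. - 1 < b u \<and> b u < 1"
    and b_odd: "\<And>u. b (- u) = - b u"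
    and b_strict_mono: "strict_mono b"
    and b_lipschitz: "L-lipschitz_on UNIV b"
    and b_slope: "\<And>M. M > 0 \<Longrightarrow>
      (INF (u, v)\<in>{(u, v). - M \<le> v \<and> v < u \<and> u \<le> M}. (b u - b v) / (u - v)) > 0"
    and S_measurable: "\<And>i j. i \<noteq> j \<Longrightarrow> S i j \<in> borel_measurable P"
    and S_range: "\<And>i j. i \<noteq> j \<Longrightarrow> AE \<omega> in P. S i j \<omega> \<in> {- 1..1}"
    and S_mean: "\<And>i j. i \<noteq> j \<Longrightarrow> expectation (S i j) = b (\<rho> $ i - \<rho> $ j)"
    and S_antisym: "\<And>i j. i \<noteq> j \<Longrightarrow> AE \<omega> in P. S j i \<omega> = - S i j \<omega>"
    and K_pos: "K > 0"
    and K_L: "K * L < 1"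
    and S_near_minus_one: "\<And>i j \<epsilon>. i \<noteq> j \<Longrightarrow> \<epsilon> > 0 \<Longrightarrow> \<P>(\<omega> in P. S i j \<omega> < - 1 + \<epsilon>) > 0"
    and S_near_one: "\<And>i j \<epsilon>. i \<noteq> j \<Longrightarrow> \<epsilon> > 0 \<Longrightarrow> \<P>(\<omega> in P. S i j \<omega> > 1 - \<epsilon>) > 0"

abbreviation game_space :: "(('n \<times> 'n) \<times> real) measure" where
  "game_space \<equiv> count_space UNIV \<Otimes>\<^sub>M borel"

text \<open>
  The law of \<open>((I, J), s)\<close>, where \<open>(I, J)\<close> is uniform among the ordered pairs of distinct players
  and, given \<open>(I, J) = (i, j)\<close>, \<open>s\<close> has the law of \<open>S i j\<close>.
\<close>

definition game_law :: "'s measure \<Rightarrow> ('n::finite \<Rightarrow> 'n \<Rightarrow> 's \<Rightarrow> real) \<Rightarrow> (('n \<times> 'n) \<times> real) measure" where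
  "game_law P S = measure_pmf (pmf_of_set {(i, j). i \<noteq> j}) \<bind>
     (\<lambda>(i, j). distr P game_space (\<lambda>\<omega>. ((i, j), S i j \<omega>)))"

fun elo_update :: "(real \<Rightarrow> real) \<Rightarrow> real \<Rightarrow> real ^ 'n \<Rightarrow> ('n::finite \<times> 'n) \<times> real \<Rightarrow> real ^ 'n" where
  "elo_update b K x ((i, j), s) = x + (K * (s - b (x $ i - x $ j))) *\<^sub>R (axis i 1 - axis j 1)"

text \<open>
  The driving variable \<open>Y t = ((I\<^sub>t, J\<^sub>t), S\<^sub>t)\<close> is the game played at step \<open>t\<close>. It is independent
  of the whole past, i.e. of \<open>X\<^sub>0, \<dots>, X\<^sub>t\<close> and \<open>Y\<^sub>0, \<dots>, Y\<^sub>t\<^sub>-\<^sub>1\<close> jointly.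
\<close>

definition elo_process ::
  "'s measure \<Rightarrow> ('n::finite \<Rightarrow> 'n \<Rightarrow> 's \<Rightarrow> real) \<Rightarrow> (real \<Rightarrow> real) \<Rightarrow> real \<Rightarrow>
   'w measure \<Rightarrow> (nat \<Rightarrow> 'w \<Rightarrow> real ^ 'n) \<Rightarrow> (nat \<Rightarrow> 'w \<Rightarrow> ('n \<times> 'n) \<times> real) \<Rightarrow> bool" where
  "elo_process P S b K M X Y \<longleftrightarrow>
     prob_space M \<and>
     (\<forall>t. X t \<in> borel_measurable M) \<and>
     (AE \<omega> in M. X 0 \<omega> \<in> zero_sum) \<and>
     (\<forall>t. Y t \<in> measurable M game_space) \<and>
     (\<forall>t. distr M game_space (Y t) = game_law P S) \<and>
     (\<forall>t. prob_space.indep_set M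
        (sets (vimage_algebra (space M) (\<lambda>\<omega>. (\<lambda>s\<in>{..t}. X s \<omega>, \<lambda>s\<in>{..<t}. Y s \<omega>))
          (Pi\<^sub>M {..t} (\<lambda>_. borel) \<Otimes>\<^sub>M Pi\<^sub>M {..<t} (\<lambda>_. game_space))))
        (sets (vimage_algebra (space M) (Y t) game_space))) \<and>
     (\<forall>t. \<forall>\<omega>\<in>space M. X (Suc t) \<omega> = elo_update b K (X t \<omega>) (Y t \<omega>))"

text \<open>The law of \<open>X\<^sub>1\<close> conditional on \<open>X\<^sub>0 = x\<close>.\<close>

definition elo_kernel ::
  "'s measure \<Rightarrow> ('n::finite \<Rightarrow> 'n \<Rightarrow> 's \<Rightarrow> real) \<Rightarrow> (real \<Rightarrow> real) \<Rightarrow> real \<Rightarrow>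
   real ^ 'n \<Rightarrow> (real ^ 'n) measure" where
  "elo_kernel P S b K x = distr (game_law P S) borel (elo_update b K x)"

text \<open>
  Probability measures on the closed set \<^const>\<open>zero_sum\<close> are encoded as Borel probability
  measures on the ambient space that are concentrated on \<^const>\<open>zero_sum\<close>.
\<close>

definition elo_stationary ::
  "'s measure \<Rightarrow> ('n::finite \<Rightarrow> 'n \<Rightarrow> 's \<Rightarrow> real) \<Rightarrow> (real \<Rightarrow> real) \<Rightarrow> real \<Rightarrow>
   (real ^ 'n) measure \<Rightarrow> bool" where
  "elo_stationary P S b K \<pi> \<longleftrightarrow>
     prob_space \<pi> \<and> sets \<pi> = sets borel \<and> (AE x in \<pi>. x \<in> zero_sum) \<and>
     \<pi> \<bind> elo_kernel P S b K = \<pi>"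

definition drift_constant ::
  "'s measure \<Rightarrow> ('n::finite \<Rightarrow> 'n \<Rightarrow> 's \<Rightarrow> real) \<Rightarrow> (real \<Rightarrow> real) \<Rightarrow> real \<Rightarrow> real \<Rightarrow> bool" where
  "drift_constant P S b K \<theta>\<^sub>0 \<longleftrightarrow>
     \<theta>\<^sub>0 > 0 \<and>
     (\<forall>\<theta>\<in>{0<..\<theta>\<^sub>0}. \<exists>l\<in>{0<..<1}. \<exists>R>0. \<exists>c>0. \<forall>x\<in>zero_sum.
        (\<integral>y. exp (\<theta> * norm y) \<partial>elo_kernel P S b K x)
          \<le> l * exp (\<theta> * norm x) + c * indicator (cball 0 R) x)"

text \<open>
  The library's \<^const>\<open>weak_conv_m\<close> is specific to the real line. For measures concentrated on a
  closed set, testing against bounded continuous functions on the ambient Euclidean space is the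
  same as testing against those on the closed set, by Tietze extension.
\<close>

definition converges_weakly :: "(nat \<Rightarrow> 'a::euclidean_space measure) \<Rightarrow> 'a measure \<Rightarrow> bool" where
  "converges_weakly \<mu> \<nu> \<longleftrightarrow>
     (\<forall>f :: 'a \<Rightarrow> real. continuous_on UNIV f \<longrightarrow> bounded (range f) \<longrightarrow>
        (\<lambda>t. \<integral>x. f x \<partial>\<mu> t) \<longlonglongrightarrow> (\<integral>x. f x \<partial>\<nu>))"

definition couplings ::
  "'a::euclidean_space measure \<Rightarrow> 'a measure \<Rightarrow> ('a \<times> 'a) measure set" where
  "couplings \<mu> \<nu> = {\<gamma>. sets \<gamma> = sets (borel \<Otimes>\<^sub>M borel) \<and>
     distr \<gamma> borel fst = \<mu> \<and> distr \<gamma> borel snd = \<nu>}"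

definition ennreal_powr :: "ennreal \<Rightarrow> real \<Rightarrow> ennreal" where
  "ennreal_powr a r = (if a = \<infinity> then \<infinity> else ennreal (enn2real a powr r))"

text \<open>The Wasserstein distance takes the value \<open>\<infinity>\<close> if no coupling has a finite cost.\<close>

definition wasserstein :: "real \<Rightarrow> 'a::euclidean_space measure \<Rightarrow> 'a measure \<Rightarrow> ennreal" where
  "wasserstein p \<mu> \<nu> =
     (INF \<gamma>\<in>couplings \<mu> \<nu>.
        ennreal_powr (\<integral>\<^sup>+ (y, z). ennreal (norm (y - z) powr p) \<partial>\<gamma>) (1 / p))"

end

theory Submission
  imports Defs
begin

text \<open>
  Run two copies of the Elo chain on the same games. If \<open>u\<close> and \<open>v\<close> are the rating gaps between \<open>i\<close>
  and \<open>j\<close> in the two copies, then a game of \<open>i\<close> against \<open>j\<close> changes the squared distance of the copies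
  by at most \<open>- 2 K (1 - K L) (u - v) (b u - b v)\<close>. Since \<open>b\<close> increases and \<open>K L < 1\<close>, no game ever
  drives the copies apart. On a bounded set \<open>b\<close> has slope at least some \<open>\<ell> > 0\<close>, and on the zero-sum
  hyperplane the squares \<open>(u - v)\<^sup>2\<close> over all pairs add up to \<open>2 N\<close> times the squared distance of the
  copies, so that in expectation it shrinks by a constant factor.

  Far from the origin this factor degenerates, and the exponential drift takes over. The two effects
  are combined in the weighted distance \<open>|x - x'| sqrt (1 + \<beta> (V x + V x'))\<close> with \<open>V x = exp (\<theta> |x|)\<close>:
  by the inequality between arithmetic and geometric means it is enough that one of the squared
  distance and the weight contracts by more than the other one can grow. In a large ball the distance
  contracts and the weight grows by little if \<open>\<beta>\<close> is small; outside of it the weight contracts. Hence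
  the weighted distance contracts on average by one factor \<open>\<alpha> < 1\<close> everywhere.

  The rest holds for any such iteration of random maps (locale \<open>contractive_ifs\<close>). Composing the maps
  in reverse order gives, at each time, a variable with the law of the chain at that time, but now
  the successive variables differ by an amount of expectation \<open>O(\<alpha>\<^sup>t)\<close>, so that they converge almost
  surely, to a limit that does not depend on the starting point. Its law is stationary, which gives
  existence without any compactness argument; dominated convergence gives weak convergence and hence
  uniqueness. For the Wasserstein distance two starting points, one of them stationary, are driven by
  the same maps: their distance tends to zero and never exceeds its initial value, which dominates it.

  Finally, since increments are bounded, the drift inequality at \<open>\<theta>\<^sub>0\<close> extends to some \<open>\<theta> > \<theta>\<^sub>0\<close>.
  The integral of \<open>exp (\<theta> |x|)\<close> is then finite by Fatou's lemma, and the surplus \<open>\<theta> - \<theta>\<^sub>0\<close> absorbs any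
  power of the norm.
\<close>

section \<open>Measure-theoretic and analytic tools\<close>

text \<open>
  The expectation of the whole series is finite by Tonelli. This is how contraction in mean becomes
  almost sure convergence.
\<close>

lemma AE_summable_of_geometric_nn_integral:
  fixes u :: "nat \<Rightarrow> 'a \<Rightarrow> real"
  assumes [measurable]: "\<And>t. u t \<in> borel_measurable M"
    and nonneg: "\<And>t \<omega>. 0 \<le> u t \<omega>"
    and bound: "\<And>t. (\<integral>\<^sup>+\<omega>. ennreal (u t \<omega>) \<partial>M) \<le> ennreal (a ^ t) * B"
    and "0 \<le> a" "a < 1" "B < \<top>"
  shows "AE \<omega> in M. summable (\<lambda>t. u t \<omega>)"
proof -
  have "(\<Sum>t. ennreal (a ^ t)) = ennreal (\<Sum>t. a ^ t)"
    by (rule suminf_ennreal2) (use assms in \<open>auto intro: summable_geometric\<close>)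
  then have geo: "(\<Sum>t. ennreal (a ^ t)) < \<top>"
    by (simp only: ennreal_less_top)
  have "(\<integral>\<^sup>+\<omega>. (\<Sum>t. ennreal (u t \<omega>)) \<partial>M) = (\<Sum>t. \<integral>\<^sup>+\<omega>. ennreal (u t \<omega>) \<partial>M)"
    by (intro nn_integral_suminf) simp
  also have "\<dots> \<le> (\<Sum>t. ennreal (a ^ t) * B)"
    by (intro suminf_le bound) simp_all
  also have "\<dots> = (\<Sum>t. ennreal (a ^ t)) * B"
    by (rule ennreal_suminf_multc)
  also have "\<dots> < \<top>"
    using geo \<open>B < \<top>\<close> by (simp add: ennreal_mult_less_top)
  finally have "AE \<omega> in M. (\<Sum>t. ennreal (u t \<omega>)) \<noteq> \<infinity>"
    by (intro nn_integral_PInf_AE) auto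
  then show ?thesis
    by eventually_elim (rule summable_suminf_not_top[OF nonneg], simp)
qed

lemma measure_eqI_nn_integral:
  assumes sets: "sets M = sets N"
    and eq: "\<And>f. f \<in> borel_measurable M \<Longrightarrow> (\<integral>\<^sup>+x. f x \<partial>M) = (\<integral>\<^sup>+x. f x \<partial>N)"
  shows "M = N"
proof (rule measure_eqI[OF sets])
  fix A assume "A \<in> sets M"
  then show "emeasure M A = emeasure N A"
    using eq[of "indicator A"] sets by (metis borel_measurable_indicator nn_integral_indicator)
qed

text \<open>
  The indicator of a closed set \<open>A\<close> is the decreasing limit of the functions
  \<open>max 0 (1 - n * infdist x A)\<close>, and the closed sets generate the Borel sets.
\<close>

lemma measure_eqI_bounded_continuous:
  fixes \<mu> \<nu> :: "'a::metric_space measure"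
  assumes "prob_space \<mu>" "prob_space \<nu>"
    and sets: "sets \<mu> = sets borel" "sets \<nu> = sets borel"
    and eq: "\<And>f :: 'a \<Rightarrow> real. continuous_on UNIV f \<Longrightarrow> bounded (range f) \<Longrightarrow>
      (\<integral>x. f x \<partial>\<mu>) = (\<integral>x. f x \<partial>\<nu>)"
  shows "\<mu> = \<nu>"
proof -
  interpret \<mu>: prob_space \<mu> by fact
  interpret \<nu>: prob_space \<nu> by fact
  have closed_eq: "emeasure \<mu> A = emeasure \<nu> A" if "closed A" for A
  proof (cases "A = {}")
    case False
    define f :: "nat \<Rightarrow> 'a \<Rightarrow> real" where "f n x = max 0 (1 - real n * infdist x A)" for n x
    have cont: "continuous_on UNIV (f n)" for n
      unfolding f_def by (intro continuous_intros)
    have range: "0 \<le> f n x" "f n x \<le> 1" for n x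
      unfolding f_def by (auto simp: infdist_nonneg)
    have bdd: "bounded (range (f n))" for n
      by (rule boundedI[of _ 1]) (use range in auto)
    have lim: "(\<lambda>n. f n x) \<longlonglongrightarrow> indicator A x" for x
    proof (cases "x \<in> A")
      case True
      then show ?thesis by (simp add: f_def)
    next
      case xA: False
      then have "infdist x A > 0"
        using \<open>closed A\<close> False by (metis in_closed_iff_infdist_zero infdist_nonneg less_eq_real_def)
      then have "eventually (\<lambda>n. real n * infdist x A \<ge> 1) sequentially"
        by (intro eventually_sequentiallyI[of "nat \<lceil>1 / infdist x A\<rceil>"])
           (simp add: field_simps ceiling_le_iff nat_le_iff)
      then have "eventually (\<lambda>n. f n x = 0) sequentially"
        by eventually_elim (simp add: f_def)
      then show ?thesis using xA by (simp add: tendsto_eventually)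
    qed
    have int: "(\<lambda>n. \<integral>x. f n x \<partial>\<kappa>) \<longlonglongrightarrow> measure \<kappa> A"
      if "prob_space \<kappa>" and s: "sets \<kappa> = sets borel" for \<kappa>
    proof -
      interpret \<kappa>: prob_space \<kappa> by fact
      have [measurable]: "A \<in> sets \<kappa>" using \<open>closed A\<close> s by simp
      have [measurable]: "f n \<in> borel_measurable \<kappa>" for n
        using borel_measurable_continuous_onI[OF cont[of n]] by (simp cong: measurable_cong_sets add: s)
      have "(\<lambda>n. \<integral>x. f n x \<partial>\<kappa>) \<longlonglongrightarrow> (\<integral>x. indicator A x \<partial>\<kappa>)"
        by (rule integral_dominated_convergence[where w = "\<lambda>_. 1"]) (use lim range in auto)
      moreover have "A \<subseteq> space \<kappa>" by (rule sets.sets_into_space) simp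
      ultimately show ?thesis by (simp add: Int_absorb2)
    qed
    have "measure \<mu> A = measure \<nu> A"
      by (rule LIMSEQ_unique[OF int[OF assms(1) sets(1)]])
         (simp add: eq[OF cont bdd] int[OF assms(2) sets(2)])
    then show ?thesis by (simp add: \<mu>.emeasure_eq_measure \<nu>.emeasure_eq_measure)
  qed simp
  have gen: "sets (borel :: 'a measure) = sigma_sets UNIV (Collect closed)"
    by (simp add: borel_eq_closed)
  show ?thesis
    by (rule measure_eqI_generator_eq[where E = "Collect closed" and \<Omega> = UNIV and A = "\<lambda>_. UNIV"])
       (auto simp: Int_stable_def sets gen[symmetric] closed_eq)
qed

lemma tendsto_ennreal_powr_0:
  assumes a: "(a \<longlongrightarrow> 0) F" and "0 < r"
  shows "((\<lambda>t. ennreal_powr (a t) r) \<longlongrightarrow> 0) F"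
proof -
  have "((\<lambda>t. enn2real (a t)) \<longlongrightarrow> 0) F"
    using tendsto_enn2real[OF a[folded ennreal_0]] by simp
  then have "((\<lambda>t. enn2real (a t) powr r) \<longlongrightarrow> 0) F"
    using \<open>0 < r\<close> by (intro tendsto_zero_powrI[where b = r]) auto
  then have "((\<lambda>t. ennreal (enn2real (a t) powr r)) \<longlongrightarrow> 0) F"
    using tendsto_ennrealI[of _ 0] by simp
  moreover have "\<forall>\<^sub>F t in F. ennreal (enn2real (a t) powr r) = ennreal_powr (a t) r"
    using order_tendstoD(2)[OF a ennreal_zero_less_top] by eventually_elim (auto simp: ennreal_powr_def)
  ultimately show ?thesis
    by (rule Lim_transform_eventually)
qed

lemma norm_diff_powr_le:
  fixes x y :: "'a::real_normed_vector"
  assumes "0 \<le> p"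
  shows "norm (x - y) powr p \<le> 2 powr p * (norm x powr p + norm y powr p)"
proof -
  have "norm (x - y) \<le> 2 * max (norm x) (norm y)"
    using norm_triangle_ineq4[of x y] by (simp add: max_def)
  then have "norm (x - y) powr p \<le> (2 * max (norm x) (norm y)) powr p"
    using assms by (intro powr_mono2) auto
  also have "\<dots> = 2 powr p * max (norm x) (norm y) powr p"
    by (simp add: powr_mult)
  also have "\<dots> \<le> 2 powr p * (norm x powr p + norm y powr p)"
    by (intro mult_left_mono) (auto simp: max_def)
  finally show ?thesis .
qed

text \<open>
  The exchange between distance and weight: one factor may grow if the other one contracts by more.
  The means inequality is applied to \<open>f\<^sup>2 / s\<close> and \<open>s g\<close> for the \<open>s\<close> at which the two bounds
  balance, \<open>s = u / sqrt w\<close>.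
\<close>

lemma nn_integral_mult_sqrt_le:
  fixes f g :: "'a \<Rightarrow> real"
  assumes [measurable]: "f \<in> borel_measurable M" "g \<in> borel_measurable M"
    and pos: "\<And>y. 0 \<le> f y" "\<And>y. 0 \<le> g y" "0 < u" "0 < w" "0 \<le> p" "0 \<le> q"
    and f: "(\<integral>\<^sup>+y. ennreal ((f y)\<^sup>2) \<partial>M) \<le> ennreal (p * u\<^sup>2)"
    and g: "(\<integral>\<^sup>+y. ennreal (g y) \<partial>M) \<le> ennreal (q * w)"
  shows "(\<integral>\<^sup>+y. ennreal (f y * sqrt (g y)) \<partial>M) \<le> ennreal ((p + q) / 2 * (u * sqrt w))"
proof -
  define s where "s = u / sqrt w"
  have s: "0 < s" using pos by (simp add: s_def)
  have amgm: "f y * sqrt (g y) \<le> 1 / (2 * s) * (f y)\<^sup>2 + s / 2 * g y" for y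
  proof -
    have "0 \<le> (f y - s * sqrt (g y))\<^sup>2" by simp
    also have "\<dots> = (f y)\<^sup>2 + s\<^sup>2 * g y - 2 * s * (f y * sqrt (g y))"
      using pos(2)[of y] by (simp add: power2_diff power_mult_distrib)
    finally have "2 * s * (f y * sqrt (g y)) \<le> (f y)\<^sup>2 + s\<^sup>2 * g y" by simp
    then show ?thesis using s by (simp add: field_simps power2_eq_square)
  qed
  have "(\<integral>\<^sup>+y. ennreal (f y * sqrt (g y)) \<partial>M)
      \<le> (\<integral>\<^sup>+y. ennreal (1 / (2 * s)) * ennreal ((f y)\<^sup>2) + ennreal (s / 2) * ennreal (g y) \<partial>M)"
    using amgm s pos
    by (intro nn_integral_mono) (simp flip: ennreal_mult ennreal_plus add: ennreal_leI)
  also have "\<dots> = ennreal (1 / (2 * s)) * (\<integral>\<^sup>+y. ennreal ((f y)\<^sup>2) \<partial>M) + ennreal (s / 2) * (\<integral>\<^sup>+y. ennreal (g y) \<partial>M)"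
    by (simp add: nn_integral_add nn_integral_cmult)
  also have "\<dots> \<le> ennreal (1 / (2 * s)) * ennreal (p * u\<^sup>2) + ennreal (s / 2) * ennreal (q * w)"
    by (intro add_mono mult_left_mono f g) simp_all
  also have "\<dots> = ennreal (1 / (2 * s) * (p * u\<^sup>2) + s / 2 * (q * w))"
    using s pos by (simp flip: ennreal_mult ennreal_plus)
  also have "1 / (2 * s) * (p * u\<^sup>2) + s / 2 * (q * w) = (p + q) / 2 * (u * sqrt w)"
  proof -
    have "1 / (2 * s) * (p * u\<^sup>2) = p / 2 * (u * sqrt w)"
      using pos by (simp add: s_def field_simps power2_eq_square)
    moreover have "s * w = u * sqrt w"
      using pos by (simp add: s_def real_div_sqrt flip: times_divide_eq_right)
    ultimately show ?thesis by (simp add: algebra_simps)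
  qed
  finally show ?thesis .
qed

text \<open>
  With \<open>q = p + 1\<close>, the inequality \<open>w \<le> exp w\<close> at \<open>w = \<delta> * u / q\<close> is raised to the power \<open>p\<close>; using
  \<open>q\<close> instead of \<open>p\<close> avoids a division by zero when \<open>p = 0\<close>.
\<close>

lemma powr_le_const_mult_exp:
  fixes p \<delta> :: real
  assumes "0 \<le> p" "0 < \<delta>"
  obtains A where "0 \<le> A" "\<And>u. 0 \<le> u \<Longrightarrow> u powr p \<le> A * exp (\<delta> * u)"
proof
  define q where "q = p + 1"
  have q: "0 < q" "p \<le> q" using assms by (auto simp: q_def)
  show "0 \<le> (q / \<delta>) powr p" by simp
  fix u :: real assume u: "0 \<le> u"
  have "\<delta> * u / q \<le> exp (\<delta> * u / q)"
    using exp_ge_add_one_self[of "\<delta> * u / q"] by linarith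
  then have "u \<le> q / \<delta> * exp (\<delta> * u / q)"
    using q assms by (simp add: field_simps)
  then have "u powr p \<le> (q / \<delta> * exp (\<delta> * u / q)) powr p"
    using u assms by (intro powr_mono2)
  also have "\<dots> = (q / \<delta>) powr p * exp (\<delta> * u * (p / q))"
    using q assms by (subst powr_mult) (simp_all add: exp_powr_real)
  also have "\<dots> \<le> (q / \<delta>) powr p * exp (\<delta> * u)"
  proof -
    have "p / q \<le> 1" using q by simp
    then have "\<delta> * u * (p / q) \<le> \<delta> * u"
      using u assms by (intro mult_left_le) auto
    then show ?thesis by (intro mult_left_mono) simp_all
  qed
  finally show "u powr p \<le> (q / \<delta>) powr p * exp (\<delta> * u)" .
qed

section \<open>Random iteration of maps that contract on average\<close>

text \<open>
  A chain that moves from \<open>x\<close> to \<open>F x y\<close> with \<open>y\<close> drawn from \<open>G\<close>. Two copies that use the same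
  \<open>y\<close> never move apart, and on the closed invariant set \<open>C\<close> they approach each other on average
  with respect to a function \<open>H\<close> that dominates the distance. The stationary law arises as the limit
  of iterates from \<open>z\<close>.
\<close>

locale contractive_ifs = prob_space G
  for G :: "'b measure" +
  fixes F :: "'a::euclidean_space \<Rightarrow> 'b \<Rightarrow> 'a"
    and C :: "'a set" and H :: "'a \<Rightarrow> 'a \<Rightarrow> real" and \<alpha> :: real and z :: 'a
  assumes F_measurable: "(\<lambda>(x, y). F x y) \<in> measurable (borel \<Otimes>\<^sub>M G) borel"
    and nonexpansive: "\<And>x x' y. dist (F x y) (F x' y) \<le> dist x x'"
    and closed_C: "closed C"
    and F_in_C: "\<And>x y. x \<in> C \<Longrightarrow> F x y \<in> C"
    and z_in_C: "z \<in> C"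
    and H_measurable: "(\<lambda>(x, x'). H x x') \<in> borel_measurable (borel \<Otimes>\<^sub>M borel)"
    and dist_le_H: "\<And>x x'. dist x x' \<le> H x x'"
    and alpha: "0 \<le> \<alpha>" "\<alpha> < 1"
    and contraction: "\<And>x x'. x \<in> C \<Longrightarrow> x' \<in> C \<Longrightarrow>
      (\<integral>\<^sup>+y. ennreal (H (F x y) (F x' y)) \<partial>G) \<le> ennreal \<alpha> * ennreal (H x x')"
    and first_step: "(\<integral>\<^sup>+y. ennreal (H (F z y) z) \<partial>G) < \<top>"
begin

definition kernel :: "'a \<Rightarrow> 'a measure" where
  "kernel x = distr G borel (F x)"

text \<open>
  The maps are composed in reverse: the first entry of the stream is applied last. For each fixed
  \<open>t\<close> this has the law of the chain at time \<open>t\<close>, and passing to the next \<open>t\<close> inserts a new map at the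
  inside, where its effect is damped by all the others.
\<close>

primrec backward :: "nat \<Rightarrow> 'a \<Rightarrow> 'b stream \<Rightarrow> 'a" where
  "backward 0 x \<omega> = x"
| "backward (Suc t) x \<omega> = F (backward t x (stl \<omega>)) (shd \<omega>)"

abbreviation \<S> :: "'b stream measure" where
  "\<S> \<equiv> stream_space G"

sublocale S: prob_space \<S>
  by (rule prob_space_stream_space)

lemma measurable_F[measurable (raw)]:
  assumes "f \<in> borel_measurable M" "g \<in> measurable M G"
  shows "(\<lambda>\<omega>. F (f \<omega>) (g \<omega>)) \<in> borel_measurable M"
  using measurable_compose[OF measurable_Pair[OF assms] F_measurable] by simp

lemma measurable_H[measurable (raw)]:
  assumes "f \<in> borel_measurable M" "g \<in> borel_measurable M"
  shows "(\<lambda>\<omega>. H (f \<omega>) (g \<omega>)) \<in> borel_measurable M"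
  using measurable_compose[OF measurable_Pair[OF assms] H_measurable] by simp

lemma measurable_backward[measurable (raw)]:
  assumes "f \<in> borel_measurable M" "g \<in> measurable M \<S>"
  shows "(\<lambda>\<omega>. backward t (f \<omega>) (g \<omega>)) \<in> borel_measurable M"
  using assms by (induction t arbitrary: g) simp_all

lemma continuous_on_F: "continuous_on UNIV (\<lambda>x. F x y)"
  unfolding continuous_on_iff by (meson nonexpansive le_less_trans)

lemma dist_backward_le: "dist (backward t x \<omega>) (backward t x' \<omega>) \<le> dist x x'"
  by (induction t arbitrary: \<omega>) (auto intro: order_trans[OF nonexpansive])

lemma backward_in_C: "x \<in> C \<Longrightarrow> backward t x \<omega> \<in> C"
  by (induction t arbitrary: \<omega>) (auto intro: F_in_C)

text \<open>
  Head and tail of the stream are independent; the head is integrated first, so that the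
  one-step assumptions apply pointwise to the inner integral.
\<close>

lemma nn_integral_shd_stl:
  assumes [measurable]: "(\<lambda>(y, \<omega>). f y \<omega>) \<in> borel_measurable (G \<Otimes>\<^sub>M \<S>)"
  shows "(\<integral>\<^sup>+\<omega>. f (shd \<omega>) (stl \<omega>) \<partial>\<S>) = (\<integral>\<^sup>+\<omega>. (\<integral>\<^sup>+y. f y \<omega> \<partial>G) \<partial>\<S>)"
proof -
  interpret GS: pair_sigma_finite G \<S> ..
  have "(\<integral>\<^sup>+\<omega>. f (shd \<omega>) (stl \<omega>) \<partial>\<S>) = (\<integral>\<^sup>+y. (\<integral>\<^sup>+\<omega>. f y \<omega> \<partial>\<S>) \<partial>G)"
    by (subst nn_integral_stream_space) simp_all
  also have "\<dots> = (\<integral>\<^sup>+\<omega>. (\<integral>\<^sup>+y. f y \<omega> \<partial>G) \<partial>\<S>)"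
    by (rule GS.Fubini'[symmetric]) simp
  finally show ?thesis .
qed

lemma distr_stl: "distr \<S> \<S> stl = \<S>"
proof (rule measure_eqI_nn_integral)
  fix f :: "_ \<Rightarrow> ennreal" assume "f \<in> borel_measurable (distr \<S> \<S> stl)"
  then have [measurable]: "f \<in> borel_measurable \<S>" by simp
  show "(\<integral>\<^sup>+\<omega>. f \<omega> \<partial>distr \<S> \<S> stl) = (\<integral>\<^sup>+\<omega>. f \<omega> \<partial>\<S>)"
    using nn_integral_shd_stl[of "\<lambda>y \<omega>. f \<omega>"] by (simp add: nn_integral_distr emeasure_space_1)
qed simp

lemma AE_stl: "(AE \<omega> in \<S>. R \<omega>) \<Longrightarrow> AE \<omega> in \<S>. R (stl \<omega>)"
  using AE_distrD[of stl \<S> \<S> R] by (simp only: distr_stl measurable_stl)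

lemma nn_integral_H_backward:
  assumes x: "x \<in> C" "x' \<in> C"
  shows "(\<integral>\<^sup>+\<omega>. ennreal (H (backward t x \<omega>) (backward t x' \<omega>)) \<partial>\<S>) \<le> ennreal (\<alpha> ^ t) * ennreal (H x x')"
proof (induction t)
  case 0
  show ?case by (simp add: S.emeasure_space_1)
next
  case (Suc t)
  have "(\<integral>\<^sup>+\<omega>. ennreal (H (backward (Suc t) x \<omega>) (backward (Suc t) x' \<omega>)) \<partial>\<S>)
      = (\<integral>\<^sup>+\<omega>. (\<integral>\<^sup>+y. ennreal (H (F (backward t x \<omega>) y) (F (backward t x' \<omega>) y)) \<partial>G) \<partial>\<S>)"
    using nn_integral_shd_stl[of "\<lambda>y \<omega>. ennreal (H (F (backward t x \<omega>) y) (F (backward t x' \<omega>) y))"]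
    by simp
  also have "\<dots> \<le> (\<integral>\<^sup>+\<omega>. ennreal \<alpha> * ennreal (H (backward t x \<omega>) (backward t x' \<omega>)) \<partial>\<S>)"
    by (intro nn_integral_mono contraction backward_in_C x)
  also have "\<dots> = ennreal \<alpha> * (\<integral>\<^sup>+\<omega>. ennreal (H (backward t x \<omega>) (backward t x' \<omega>)) \<partial>\<S>)"
    by (intro nn_integral_cmult) simp
  also have "\<dots> \<le> ennreal \<alpha> * (ennreal (\<alpha> ^ t) * ennreal (H x x'))"
    by (intro mult_left_mono Suc) simp
  finally show ?case using alpha by (simp add: ennreal_mult mult.assoc)
qed

text \<open>
  The distance is at most \<open>H\<close>, whose expectation decays geometrically.
\<close>

lemma AE_backward_synchronize:
  assumes x: "x \<in> C" "x' \<in> C"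
  shows "AE \<omega> in \<S>. (\<lambda>t. dist (backward t x \<omega>) (backward t x' \<omega>)) \<longlonglongrightarrow> 0"
proof -
  have "AE \<omega> in \<S>. summable (\<lambda>t. dist (backward t x \<omega>) (backward t x' \<omega>))"
  proof (rule AE_summable_of_geometric_nn_integral[where a = \<alpha> and B = "ennreal (H x x')"])
    fix t
    have "(\<integral>\<^sup>+\<omega>. ennreal (dist (backward t x \<omega>) (backward t x' \<omega>)) \<partial>\<S>)
        \<le> (\<integral>\<^sup>+\<omega>. ennreal (H (backward t x \<omega>) (backward t x' \<omega>)) \<partial>\<S>)"
      by (intro nn_integral_mono ennreal_leI dist_le_H)
    also note nn_integral_H_backward[OF x]
    finally show "(\<integral>\<^sup>+\<omega>. ennreal (dist (backward t x \<omega>) (backward t x' \<omega>)) \<partial>\<S>)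
        \<le> ennreal (\<alpha> ^ t) * ennreal (H x x')" .
  qed (use alpha in auto)
  then show ?thesis
    by eventually_elim (rule summable_LIMSEQ_zero)
qed

definition limit :: "'b stream \<Rightarrow> 'a" where
  "limit \<omega> = lim (\<lambda>t. backward t z \<omega>)"

lemma measurable_limit[measurable]: "limit \<in> borel_measurable \<S>"
  unfolding limit_def[abs_def] by measurable

text \<open>
  Successive iterates from \<open>z\<close> arise from the pair \<open>F z y, z\<close> by applying the same maps, so their
  distances are summable; every other starting point in \<open>C\<close> leads to the same limit by
  synchronization.
\<close>

lemma AE_backward_tendsto_limit:
  assumes x: "x \<in> C"
  shows "AE \<omega> in \<S>. (\<lambda>t. backward t x \<omega>) \<longlonglongrightarrow> limit \<omega>"
proof -
  have "(\<integral>\<^sup>+\<omega>. ennreal (H (backward (Suc t) z \<omega>) (backward t z \<omega>)) \<partial>\<S>)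
      \<le> ennreal (\<alpha> ^ t) * (\<integral>\<^sup>+y. ennreal (H (F z y) z) \<partial>G)" for t
  proof (induction t)
    case 0
    show ?case
      using nn_integral_shd_stl[of "\<lambda>y \<omega>. ennreal (H (F z y) z)"]
      by (simp add: S.emeasure_space_1)
  next
    case (Suc t)
    have "(\<integral>\<^sup>+\<omega>. ennreal (H (backward (Suc (Suc t)) z \<omega>) (backward (Suc t) z \<omega>)) \<partial>\<S>)
        = (\<integral>\<^sup>+\<omega>. (\<integral>\<^sup>+y. ennreal (H (F (backward (Suc t) z \<omega>) y) (F (backward t z \<omega>) y)) \<partial>G) \<partial>\<S>)"
      using nn_integral_shd_stl[of "\<lambda>y \<omega>. ennreal (H (F (backward (Suc t) z \<omega>) y) (F (backward t z \<omega>) y))"]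
      by simp
    also have "\<dots> \<le> (\<integral>\<^sup>+\<omega>. ennreal \<alpha> * ennreal (H (backward (Suc t) z \<omega>) (backward t z \<omega>)) \<partial>\<S>)"
      by (intro nn_integral_mono contraction backward_in_C z_in_C)
    also have "\<dots> = ennreal \<alpha> * (\<integral>\<^sup>+\<omega>. ennreal (H (backward (Suc t) z \<omega>) (backward t z \<omega>)) \<partial>\<S>)"
      by (intro nn_integral_cmult) simp
    also have "\<dots> \<le> ennreal \<alpha> * (ennreal (\<alpha> ^ t) * (\<integral>\<^sup>+y. ennreal (H (F z y) z) \<partial>G))"
      by (intro mult_left_mono Suc) simp
    finally show ?case using alpha by (simp add: ennreal_mult mult.assoc)
  qed
  then have "(\<integral>\<^sup>+\<omega>. ennreal (dist (backward (Suc t) z \<omega>) (backward t z \<omega>)) \<partial>\<S>)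
      \<le> ennreal (\<alpha> ^ t) * (\<integral>\<^sup>+y. ennreal (H (F z y) z) \<partial>G)" for t
    by (rule order_trans[rotated]) (intro nn_integral_mono ennreal_leI dist_le_H)
  then have "AE \<omega> in \<S>. summable (\<lambda>t. dist (backward (Suc t) z \<omega>) (backward t z \<omega>))"
    by (rule AE_summable_of_geometric_nn_integral[rotated 2]) (use alpha first_step in auto)
  then have "AE \<omega> in \<S>. (\<lambda>t. backward t z \<omega>) \<longlonglongrightarrow> limit \<omega>"
  proof eventually_elim
    fix \<omega>
    assume "summable (\<lambda>t. dist (backward (Suc t) z \<omega>) (backward t z \<omega>))"
    then have "summable (\<lambda>t. backward (Suc t) z \<omega> - backward t z \<omega>)"
      unfolding dist_norm by (rule summable_norm_cancel)
    then have "convergent (\<lambda>t. backward t z \<omega>)"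
      unfolding summable_iff_convergent sum_lessThan_telescope[of "\<lambda>t. backward t z \<omega>"]
      by (simp only: convergent_diff_const_right_iff)
    then show "(\<lambda>t. backward t z \<omega>) \<longlonglongrightarrow> limit \<omega>"
      by (simp add: convergent_LIMSEQ_iff limit_def)
  qed
  with AE_backward_synchronize[OF x z_in_C] show ?thesis
  proof eventually_elim
    fix \<omega>
    assume sync: "(\<lambda>t. dist (backward t x \<omega>) (backward t z \<omega>)) \<longlonglongrightarrow> 0"
      and lim: "(\<lambda>t. backward t z \<omega>) \<longlonglongrightarrow> limit \<omega>"
    show "(\<lambda>t. backward t x \<omega>) \<longlonglongrightarrow> limit \<omega>"
      by (rule Lim_transform[OF lim tendsto_norm_zero_cancel]) (use sync in \<open>simp add: dist_norm\<close>)
  qed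
qed

lemma kernel_measurable[measurable]: "kernel \<in> measurable borel (subprob_algebra borel)"
  unfolding kernel_def[abs_def]
  by (rule measurable_distr2[where M = G]) (auto intro!: measurable_const simp: space_subprob_algebra F_measurable
      prob_space_imp_subprob_space prob_space_axioms)

lemma nn_integral_bind_kernel:
  assumes \<nu>: "sets \<nu> = sets borel" and [measurable]: "f \<in> borel_measurable borel"
  shows "(\<integral>\<^sup>+x. f x \<partial>(\<nu> \<bind> kernel)) = (\<integral>\<^sup>+x. (\<integral>\<^sup>+y. f (F x y) \<partial>G) \<partial>\<nu>)"
proof -
  have "kernel \<in> measurable \<nu> (subprob_algebra borel)"
    using kernel_measurable by (simp cong: measurable_cong_sets add: \<nu>)
  then have "(\<integral>\<^sup>+x. f x \<partial>(\<nu> \<bind> kernel)) = (\<integral>\<^sup>+x. (\<integral>\<^sup>+y. f y \<partial>kernel x) \<partial>\<nu>)"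
    by (rule nn_integral_bind[rotated]) simp
  then show ?thesis
    by (simp add: kernel_def nn_integral_distr)
qed

lemma sets_bind_kernel:
  assumes "prob_space \<nu>" "sets \<nu> = sets borel"
  shows "sets (\<nu> \<bind> kernel) = sets borel"
  by (rule sets_bind) (auto simp: kernel_def prob_space.not_empty[OF assms(1)])

text \<open>
  The law at time \<open>t\<close> of the chain started from \<open>\<mu>\<close>, realized on a product space on which chains
  with different starting points can be coupled.
\<close>

definition law :: "'a measure \<Rightarrow> nat \<Rightarrow> 'a measure" where
  "law \<mu> t = distr (\<mu> \<Otimes>\<^sub>M \<S>) borel (\<lambda>(x, \<omega>). backward t x \<omega>)"

lemma prob_space_law:
  assumes "prob_space \<mu>" and [measurable_cong]: "sets \<mu> = sets borel"
  shows "prob_space (law \<mu> t)"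
proof -
  interpret \<mu>: prob_space \<mu> by fact
  interpret \<mu>S: pair_prob_space \<mu> \<S> ..
  show ?thesis unfolding law_def by (rule \<mu>S.prob_space_distr) simp
qed

lemma nn_integral_law:
  assumes [measurable_cong]: "sets \<mu> = sets borel" and [measurable]: "f \<in> borel_measurable borel"
  shows "(\<integral>\<^sup>+x. f x \<partial>law \<mu> t) = (\<integral>\<^sup>+x. (\<integral>\<^sup>+\<omega>. f (backward t x \<omega>) \<partial>\<S>) \<partial>\<mu>)"
  unfolding law_def
  by (subst nn_integral_distr) (simp_all flip: S.nn_integral_fst add: split_beta')

lemma sets_law[simp, measurable_cong]: "sets (law \<mu> t) = sets borel"
  by (simp add: law_def)

lemma law_0:
  assumes s[measurable_cong]: "sets \<mu> = sets borel"
  shows "law \<mu> 0 = \<mu>"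
  by (rule measure_eqI_nn_integral)
     (simp_all add: s nn_integral_law[OF s] S.emeasure_space_1 cong: measurable_cong_sets)

lemma law_Suc:
  assumes \<mu>: "prob_space \<mu>" and s[measurable_cong]: "sets \<mu> = sets borel"
  shows "law \<mu> (Suc t) = law \<mu> t \<bind> kernel"
proof (rule measure_eqI_nn_integral)
  show "sets (law \<mu> (Suc t)) = sets (law \<mu> t \<bind> kernel)"
    by (simp add: sets_bind_kernel[OF prob_space_law[OF \<mu> s]])
  fix f :: "_ \<Rightarrow> ennreal" assume "f \<in> borel_measurable (law \<mu> (Suc t))"
  then have [measurable]: "f \<in> borel_measurable borel" by simp
  have "(\<integral>\<^sup>+x. f x \<partial>law \<mu> (Suc t))
      = (\<integral>\<^sup>+x. (\<integral>\<^sup>+\<omega>. (\<integral>\<^sup>+y. f (F (backward t x \<omega>) y) \<partial>G) \<partial>\<S>) \<partial>\<mu>)"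
    using nn_integral_shd_stl[of "\<lambda>y \<omega>. f (F (backward t x \<omega>) y)" for x]
    by (simp add: nn_integral_law[OF s])
  also have "\<dots> = (\<integral>\<^sup>+x. f x \<partial>(law \<mu> t \<bind> kernel))"
    by (simp add: nn_integral_bind_kernel nn_integral_law[OF s])
  finally show "(\<integral>\<^sup>+x. f x \<partial>law \<mu> (Suc t)) = (\<integral>\<^sup>+x. f x \<partial>(law \<mu> t \<bind> kernel))" .
qed

lemma law_stationary:
  assumes \<mu>: "prob_space \<mu>" "sets \<mu> = sets borel" "\<mu> \<bind> kernel = \<mu>"
  shows "law \<mu> t = \<mu>"
  by (induction t) (simp_all add: law_0 law_Suc \<mu>)

definition limit_law :: "'a measure" where
  "limit_law = distr \<S> borel limit"

lemma prob_space_limit_law: "prob_space limit_law"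
  unfolding limit_law_def by (rule S.prob_space_distr) simp

lemma sets_limit_law[simp, measurable_cong]: "sets limit_law = sets borel"
  by (simp add: limit_law_def)

lemma AE_limit_law_in_C: "AE x in limit_law. x \<in> C"
proof -
  have "AE \<omega> in \<S>. limit \<omega> \<in> C"
    using AE_backward_tendsto_limit[OF z_in_C]
    by eventually_elim (rule closed_sequentially[OF closed_C backward_in_C[OF z_in_C]])
  then show ?thesis
    unfolding limit_law_def using closed_C by (subst AE_distr_iff) auto
qed

text \<open>
  The limit satisfies the fixed point equation \<open>limit \<omega> = F (limit (stl \<omega>)) (shd \<omega>)\<close>, in which the
  two arguments on the right are independent and \<open>limit (stl \<omega>)\<close> has the same law as \<open>limit \<omega>\<close>.
\<close>

lemma limit_law_stationary: "limit_law \<bind> kernel = limit_law"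
proof (rule measure_eqI_nn_integral[symmetric])
  show "sets limit_law = sets (limit_law \<bind> kernel)"
    by (simp add: sets_bind_kernel prob_space_limit_law)
  fix f :: "'a \<Rightarrow> ennreal" assume "f \<in> borel_measurable limit_law"
  then have [measurable]: "f \<in> borel_measurable borel" by simp
  have "AE \<omega> in \<S>. limit \<omega> = F (limit (stl \<omega>)) (shd \<omega>)"
    using AE_backward_tendsto_limit[OF z_in_C] AE_stl[OF AE_backward_tendsto_limit[OF z_in_C]]
  proof eventually_elim
    fix \<omega>
    assume 1: "(\<lambda>t. backward t z \<omega>) \<longlonglongrightarrow> limit \<omega>"
      and 2: "(\<lambda>t. backward t z (stl \<omega>)) \<longlonglongrightarrow> limit (stl \<omega>)"
    have "(\<lambda>t. backward (Suc t) z \<omega>) \<longlonglongrightarrow> F (limit (stl \<omega>)) (shd \<omega>)"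
      using continuous_on_tendsto_compose[OF continuous_on_F 2] by simp
    with LIMSEQ_Suc[OF 1] show "limit \<omega> = F (limit (stl \<omega>)) (shd \<omega>)"
      by (rule LIMSEQ_unique)
  qed
  then have "(\<integral>\<^sup>+\<omega>. f (limit \<omega>) \<partial>\<S>) = (\<integral>\<^sup>+\<omega>. f (F (limit (stl \<omega>)) (shd \<omega>)) \<partial>\<S>)"
    by (intro nn_integral_cong_AE) auto
  also have "\<dots> = (\<integral>\<^sup>+\<omega>. (\<integral>\<^sup>+y. f (F (limit \<omega>) y) \<partial>G) \<partial>\<S>)"
    by (rule nn_integral_shd_stl) simp
  also have "\<dots> = (\<integral>\<^sup>+x. f x \<partial>(limit_law \<bind> kernel))"
    by (subst nn_integral_bind_kernel) (simp_all add: limit_law_def nn_integral_distr)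
  finally show "(\<integral>\<^sup>+x. f x \<partial>limit_law) = (\<integral>\<^sup>+x. f x \<partial>(limit_law \<bind> kernel))"
    by (simp add: limit_law_def nn_integral_distr)
qed

text \<open>
  For each fixed starting point the iterates converge almost surely to the limit; dominated
  convergence is applied first over the stream and then over the starting point.
\<close>

lemma law_converges_weakly:
  assumes "prob_space \<mu>" and s[measurable_cong]: "sets \<mu> = sets borel" and C: "AE x in \<mu>. x \<in> C"
  shows "converges_weakly (law \<mu>) limit_law"
  unfolding converges_weakly_def
proof (intro allI impI)
  fix f :: "'a \<Rightarrow> real"
  assume f: "continuous_on UNIV f" and "bounded (range f)"
  then obtain B where B: "\<And>x. \<bar>f x\<bar> \<le> B"
    by (auto simp: bounded_iff)
  have [measurable]: "f \<in> borel_measurable borel"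
    using f by (rule borel_measurable_continuous_onI)
  interpret \<mu>: prob_space \<mu> by fact
  interpret \<mu>S: pair_prob_space \<mu> \<S> ..
  have law: "(\<integral>x. f x \<partial>law \<mu> t) = (\<integral>x. (\<integral>\<omega>. f (backward t x \<omega>) \<partial>\<S>) \<partial>\<mu>)" for t
  proof -
    have "integrable (\<mu> \<Otimes>\<^sub>M \<S>) (\<lambda>(x, \<omega>). f (backward t x \<omega>))"
      by (rule \<mu>S.integrable_const_bound[where B = B]) (use B in auto)
    from \<mu>S.integral_fst'[OF this] show ?thesis
      unfolding law_def by (subst integral_distr) (simp_all add: split_beta')
  qed
  have pointwise: "(\<lambda>t. \<integral>\<omega>. f (backward t x \<omega>) \<partial>\<S>) \<longlonglongrightarrow> (\<integral>\<omega>. f (limit \<omega>) \<partial>\<S>)" if "x \<in> C" for x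
  proof (rule integral_dominated_convergence[where w = "\<lambda>_. B"])
    show "AE \<omega> in \<S>. (\<lambda>t. f (backward t x \<omega>)) \<longlonglongrightarrow> f (limit \<omega>)"
      using AE_backward_tendsto_limit[OF that]
      by eventually_elim (rule continuous_on_tendsto_compose[OF f], auto)
  qed (use B in auto)
  have "(\<lambda>t. \<integral>x. (\<integral>\<omega>. f (backward t x \<omega>) \<partial>\<S>) \<partial>\<mu>) \<longlonglongrightarrow> (\<integral>x. (\<integral>\<omega>. f (limit \<omega>) \<partial>\<S>) \<partial>\<mu>)"
  proof (rule integral_dominated_convergence[where w = "\<lambda>_. B"])
    show "AE x in \<mu>. (\<lambda>t. \<integral>\<omega>. f (backward t x \<omega>) \<partial>\<S>) \<longlonglongrightarrow> (\<integral>\<omega>. f (limit \<omega>) \<partial>\<S>)"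
      using C by eventually_elim (rule pointwise)
    have "norm (\<integral>\<omega>. f (backward t x \<omega>) \<partial>\<S>) \<le> B" for t x
    proof -
      have "norm (\<integral>\<omega>. f (backward t x \<omega>) \<partial>\<S>) \<le> (\<integral>\<omega>. norm (f (backward t x \<omega>)) \<partial>\<S>)"
        by (rule integral_norm_bound)
      also have "\<dots> \<le> B"
        by (rule S.integral_le_const) (use B in \<open>auto intro!: S.integrable_const_bound[where B = B]\<close>)
      finally show ?thesis .
    qed
    then show "AE x in \<mu>. norm (\<integral>\<omega>. f (backward t x \<omega>) \<partial>\<S>) \<le> B" for t by simp
  qed auto
  then show "(\<lambda>t. \<integral>x. f x \<partial>law \<mu> t) \<longlonglongrightarrow> (\<integral>x. f x \<partial>limit_law)"
    by (simp add: law limit_law_def integral_distr \<mu>.prob_space)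
qed

lemma stationary_eq_limit_law:
  assumes \<mu>: "prob_space \<mu>" "sets \<mu> = sets borel" "AE x in \<mu>. x \<in> C" "\<mu> \<bind> kernel = \<mu>"
  shows "\<mu> = limit_law"
proof (rule measure_eqI_bounded_continuous)
  fix f :: "'a \<Rightarrow> real"
  assume "continuous_on UNIV f" "bounded (range f)"
  then have "(\<lambda>t. \<integral>x. f x \<partial>law \<mu> t) \<longlonglongrightarrow> (\<integral>x. f x \<partial>limit_law)"
    using law_converges_weakly[OF \<mu>(1-3)] by (simp add: converges_weakly_def)
  then show "(\<integral>x. f x \<partial>\<mu>) = (\<integral>x. f x \<partial>limit_law)"
    by (simp add: law_stationary[OF \<mu>(1,2,4)] LIMSEQ_const_iff)
qed (simp_all add: \<mu> prob_space_limit_law)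

text \<open>
  The bound \<open>V z + c / (1 - l)\<close> is preserved by the drift inequality, hence holds for all iterates
  from \<open>z\<close>, and passes to the limit by Fatou's lemma.
\<close>

lemma nn_integral_limit_law_le:
  fixes V :: "'a \<Rightarrow> real"
  assumes cont: "continuous_on UNIV V" and "0 \<le> l" "l < 1" "0 \<le> c"
    and nonneg: "\<And>x. 0 \<le> V x"
    and drift: "\<And>x. x \<in> C \<Longrightarrow> (\<integral>\<^sup>+y. ennreal (V (F x y)) \<partial>G) \<le> ennreal (l * V x + c)"
  shows "(\<integral>\<^sup>+x. ennreal (V x) \<partial>limit_law) \<le> ennreal (V z + c / (1 - l))"
proof -
  have [measurable]: "V \<in> borel_measurable borel"
    using cont by (rule borel_measurable_continuous_onI)
  have bound: "(\<integral>\<^sup>+\<omega>. ennreal (V (backward t z \<omega>)) \<partial>\<S>) \<le> ennreal (V z + c / (1 - l))" for t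
  proof (induction t)
    case 0
    show ?case using \<open>l < 1\<close> \<open>0 \<le> c\<close> by (simp add: S.emeasure_space_1 ennreal_leI)
  next
    case (Suc t)
    have "(\<integral>\<^sup>+\<omega>. ennreal (V (backward (Suc t) z \<omega>)) \<partial>\<S>)
        = (\<integral>\<^sup>+\<omega>. (\<integral>\<^sup>+y. ennreal (V (F (backward t z \<omega>) y)) \<partial>G) \<partial>\<S>)"
      using nn_integral_shd_stl[of "\<lambda>y \<omega>. ennreal (V (F (backward t z \<omega>) y))"] by simp
    also have "\<dots> \<le> (\<integral>\<^sup>+\<omega>. ennreal l * ennreal (V (backward t z \<omega>)) + ennreal c \<partial>\<S>)"
      using drift[OF backward_in_C[OF z_in_C]] assms
      by (intro nn_integral_mono) (simp add: ennreal_mult ennreal_plus)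
    also have "\<dots> = ennreal l * (\<integral>\<^sup>+\<omega>. ennreal (V (backward t z \<omega>)) \<partial>\<S>) + ennreal c"
      by (simp add: nn_integral_add nn_integral_cmult S.emeasure_space_1)
    also have "\<dots> \<le> ennreal l * ennreal (V z + c / (1 - l)) + ennreal c"
      by (intro add_mono mult_left_mono Suc) simp_all
    also have "\<dots> = ennreal (l * (V z + c / (1 - l)) + c)"
      using assms by (simp add: ennreal_mult ennreal_plus)
    also have "\<dots> \<le> ennreal (V z + c / (1 - l))"
    proof (rule ennreal_leI)
      have "l * (V z + c / (1 - l)) + c = l * V z + c / (1 - l)"
        using \<open>l < 1\<close> by (simp add: field_simps)
      also have "\<dots> \<le> V z + c / (1 - l)"
        using \<open>l < 1\<close> \<open>0 \<le> l\<close> nonneg[of z] by (simp add: mult_left_le_one_le)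
      finally show "l * (V z + c / (1 - l)) + c \<le> V z + c / (1 - l)" .
    qed
    finally show ?case .
  qed
  have "AE \<omega> in \<S>. ennreal (V (limit \<omega>)) = liminf (\<lambda>t. ennreal (V (backward t z \<omega>)))"
    using AE_backward_tendsto_limit[OF z_in_C]
  proof eventually_elim
    fix \<omega>
    assume "(\<lambda>t. backward t z \<omega>) \<longlonglongrightarrow> limit \<omega>"
    then have "(\<lambda>t. ennreal (V (backward t z \<omega>))) \<longlonglongrightarrow> ennreal (V (limit \<omega>))"
      by (intro tendsto_ennrealI continuous_on_tendsto_compose[OF cont]) auto
    then show "ennreal (V (limit \<omega>)) = liminf (\<lambda>t. ennreal (V (backward t z \<omega>)))"
      by (simp add: lim_imp_Liminf)
  qed
  then have "(\<integral>\<^sup>+\<omega>. ennreal (V (limit \<omega>)) \<partial>\<S>)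
      = (\<integral>\<^sup>+\<omega>. liminf (\<lambda>t. ennreal (V (backward t z \<omega>))) \<partial>\<S>)"
    by (rule nn_integral_cong_AE)
  also have "\<dots> \<le> liminf (\<lambda>t. \<integral>\<^sup>+\<omega>. ennreal (V (backward t z \<omega>)) \<partial>\<S>)"
    by (rule nn_integral_liminf) simp
  also have "\<dots> \<le> liminf (\<lambda>t. ennreal (V z + c / (1 - l)))"
    by (intro Liminf_mono always_eventually allI bound)
  finally show ?thesis
    by (simp add: limit_law_def nn_integral_distr Liminf_const)
qed

text \<open>
  The coupling draws the two starting points independently and then uses the same stream. The
  distance tends to zero almost surely and is at most the initial distance, so the \<open>p\<close>-th
  moments of the initial laws suffice for dominated convergence.
\<close>

lemma law_wasserstein_tendsto_0:
  assumes \<mu>: "prob_space \<mu>" "AE x in \<mu>. x \<in> C" "(\<integral>\<^sup>+x. ennreal (norm x powr p) \<partial>\<mu>) < \<top>"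
    and \<nu>: "prob_space \<nu>" "AE x in \<nu>. x \<in> C" "(\<integral>\<^sup>+x. ennreal (norm x powr p) \<partial>\<nu>) < \<top>"
    and s[measurable_cong]: "sets \<mu> = sets borel" "sets \<nu> = sets borel"
    and "0 < p"
  shows "(\<lambda>t. wasserstein p (law \<mu> t) (law \<nu> t)) \<longlonglongrightarrow> 0"
proof -
  interpret \<mu>: prob_space \<mu> by fact
  interpret \<nu>: prob_space \<nu> by fact
  interpret \<mu>\<nu>: pair_prob_space \<mu> \<nu> ..
  define \<gamma> where "\<gamma> t = distr ((\<mu> \<Otimes>\<^sub>M \<nu>) \<Otimes>\<^sub>M \<S>) (borel \<Otimes>\<^sub>M borel)
    (\<lambda>((x, x'), \<omega>). (backward t x \<omega>, backward t x' \<omega>))" for t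
  have iterated: "(\<integral>\<^sup>+q. f q \<partial>\<gamma> t)
      = (\<integral>\<^sup>+(x, x'). (\<integral>\<^sup>+\<omega>. f (backward t x \<omega>, backward t x' \<omega>) \<partial>\<S>) \<partial>(\<mu> \<Otimes>\<^sub>M \<nu>))"
    if [measurable]: "f \<in> borel_measurable (borel \<Otimes>\<^sub>M borel)" for f t
    unfolding \<gamma>_def by (subst nn_integral_distr) (simp_all flip: S.nn_integral_fst add: split_beta')
  have coupling: "\<gamma> t \<in> couplings (law \<mu> t) (law \<nu> t)" for t
  proof -
    have sets_\<gamma>[measurable_cong]: "sets (\<gamma> t) = sets (borel \<Otimes>\<^sub>M borel)" by (simp add: \<gamma>_def)
    have "distr (\<gamma> t) borel fst = law \<mu> t"
    proof (rule measure_eqI_nn_integral)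
      fix f :: "'a \<Rightarrow> ennreal" assume "f \<in> borel_measurable (distr (\<gamma> t) borel fst)"
      then have [measurable]: "f \<in> borel_measurable borel" by simp
      have "(\<integral>\<^sup>+x. f x \<partial>distr (\<gamma> t) borel fst) = (\<integral>\<^sup>+q. f (fst q) \<partial>\<gamma> t)"
        by (rule nn_integral_distr) simp_all
      also have "\<dots> = (\<integral>\<^sup>+x. f x \<partial>law \<mu> t)"
        by (simp add: iterated nn_integral_law s \<nu>.nn_integral_fst[symmetric] split_beta' \<nu>.emeasure_space_1)
      finally show "(\<integral>\<^sup>+x. f x \<partial>distr (\<gamma> t) borel fst) = (\<integral>\<^sup>+x. f x \<partial>law \<mu> t)" .
    qed simp
    moreover have "distr (\<gamma> t) borel snd = law \<nu> t"
    proof (rule measure_eqI_nn_integral)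
      fix f :: "'a \<Rightarrow> ennreal" assume "f \<in> borel_measurable (distr (\<gamma> t) borel snd)"
      then have [measurable]: "f \<in> borel_measurable borel" by simp
      have "(\<integral>\<^sup>+x. f x \<partial>distr (\<gamma> t) borel snd) = (\<integral>\<^sup>+q. f (snd q) \<partial>\<gamma> t)"
        by (rule nn_integral_distr) simp_all
      also have "\<dots> = (\<integral>\<^sup>+x. f x \<partial>law \<nu> t)"
        by (simp add: iterated nn_integral_law s \<nu>.nn_integral_fst[symmetric] split_beta' \<mu>.emeasure_space_1)
      finally show "(\<integral>\<^sup>+x. f x \<partial>distr (\<gamma> t) borel snd) = (\<integral>\<^sup>+x. f x \<partial>law \<nu> t)" .
    qed simp
    ultimately show ?thesis by (simp add: couplings_def sets_\<gamma>)
  qed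
  define cost where "cost t x x' = (\<integral>\<^sup>+\<omega>. ennreal (norm (backward t x \<omega> - backward t x' \<omega>) powr p) \<partial>\<S>)"
    for t x x'
  have [measurable]: "(\<lambda>(x, x'). cost t x x') \<in> borel_measurable (\<mu> \<Otimes>\<^sub>M \<nu>)" for t
    unfolding cost_def by measurable
  have cost_le: "cost t x x' \<le> ennreal (2 powr p * (norm x powr p + norm x' powr p))" for t x x'
  proof -
    have "cost t x x' \<le> (\<integral>\<^sup>+\<omega>. ennreal (norm (x - x') powr p) \<partial>\<S>)"
      unfolding cost_def using dist_backward_le[of t x _ x'] \<open>0 < p\<close>
      by (intro nn_integral_mono ennreal_leI powr_mono2) (auto simp: dist_norm)
    also have "\<dots> \<le> ennreal (2 powr p * (norm x powr p + norm x' powr p))"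
      using \<open>0 < p\<close> by (simp add: S.emeasure_space_1 ennreal_leI norm_diff_powr_le)
    finally show ?thesis .
  qed
  have cost_tendsto: "(\<lambda>t. cost t x x') \<longlonglongrightarrow> 0" if "x \<in> C" "x' \<in> C" for x x'
  proof -
    have "(\<lambda>t. cost t x x') \<longlonglongrightarrow> (\<integral>\<^sup>+\<omega>. 0 \<partial>\<S>)"
      unfolding cost_def
    proof (rule nn_integral_dominated_convergence[where w = "\<lambda>_. ennreal (norm (x - x') powr p)"])
      show "AE \<omega> in \<S>. ennreal (norm (backward t x \<omega> - backward t x' \<omega>) powr p) \<le> ennreal (norm (x - x') powr p)" for t
        using dist_backward_le[of t x _ x'] \<open>0 < p\<close>
        by (intro always_eventually allI ennreal_leI powr_mono2) (auto simp: dist_norm)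
      show "AE \<omega> in \<S>. (\<lambda>t. ennreal (norm (backward t x \<omega> - backward t x' \<omega>) powr p)) \<longlonglongrightarrow> 0"
        using AE_backward_synchronize[OF that]
      proof eventually_elim
        fix \<omega>
        assume "(\<lambda>t. dist (backward t x \<omega>) (backward t x' \<omega>)) \<longlonglongrightarrow> 0"
        then have "(\<lambda>t. norm (backward t x \<omega> - backward t x' \<omega>) powr p) \<longlonglongrightarrow> 0"
          using \<open>0 < p\<close> by (intro tendsto_zero_powrI[where b = p]) (auto simp: dist_norm)
        then show "(\<lambda>t. ennreal (norm (backward t x \<omega> - backward t x' \<omega>) powr p)) \<longlonglongrightarrow> 0"
          using tendsto_ennrealI[of _ 0] by simp
      qed
    qed (simp_all add: S.emeasure_space_1)
    then show ?thesis by simp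
  qed
  have "(\<lambda>t. \<integral>\<^sup>+(x, x'). cost t x x' \<partial>(\<mu> \<Otimes>\<^sub>M \<nu>)) \<longlonglongrightarrow> (\<integral>\<^sup>+_. 0 \<partial>(\<mu> \<Otimes>\<^sub>M \<nu>))"
  proof (rule nn_integral_dominated_convergence
      [where w = "\<lambda>(x, x'). ennreal (2 powr p) * (ennreal (norm x powr p) + ennreal (norm x' powr p))"])
    have "AE x in \<mu>. AE x' in \<nu>. x \<in> C \<and> x' \<in> C"
      using \<mu>(2) by eventually_elim (use \<nu>(2) in auto)
    moreover have [measurable]: "C \<in> sets borel" using closed_C by simp
    have "{q \<in> space (\<mu> \<Otimes>\<^sub>M \<nu>). fst q \<in> C \<and> snd q \<in> C} \<in> sets (\<mu> \<Otimes>\<^sub>M \<nu>)"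
      by measurable
    ultimately have "AE q in \<mu> \<Otimes>\<^sub>M \<nu>. fst q \<in> C \<and> snd q \<in> C"
      by (intro \<mu>\<nu>.AE_pair_measure) simp_all
    then show "AE q in \<mu> \<Otimes>\<^sub>M \<nu>. (\<lambda>t. case q of (x, x') \<Rightarrow> cost t x x') \<longlonglongrightarrow> 0"
      by eventually_elim (auto intro: cost_tendsto)
    show "AE q in \<mu> \<Otimes>\<^sub>M \<nu>. (case q of (x, x') \<Rightarrow> cost t x x')
        \<le> (case q of (x, x') \<Rightarrow> ennreal (2 powr p) * (ennreal (norm x powr p) + ennreal (norm x' powr p)))" for t
      using cost_le[of t] by (auto simp: ennreal_mult ennreal_plus)
    show "(\<integral>\<^sup>+(x, x'). ennreal (2 powr p) * (ennreal (norm x powr p) + ennreal (norm x' powr p)) \<partial>(\<mu> \<Otimes>\<^sub>M \<nu>)) < \<infinity>"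
      using \<mu>(3) \<nu>(3)
      by (simp add: \<nu>.nn_integral_fst[symmetric] nn_integral_cmult nn_integral_add
          \<nu>.emeasure_space_1 \<mu>.emeasure_space_1 ennreal_mult_less_top)
  qed simp_all
  then have "(\<lambda>t. \<integral>\<^sup>+(y, y'). ennreal (norm (y - y') powr p) \<partial>\<gamma> t) \<longlonglongrightarrow> 0"
    by (simp add: iterated cost_def split_beta')
  then have "(\<lambda>t. ennreal_powr (\<integral>\<^sup>+(y, y'). ennreal (norm (y - y') powr p) \<partial>\<gamma> t) (1 / p)) \<longlonglongrightarrow> 0"
    by (rule tendsto_ennreal_powr_0) (use \<open>0 < p\<close> in simp)
  then show ?thesis
    by (rule tendsto_sandwich[OF _ _ tendsto_const, rotated 2])
       (auto simp: wasserstein_def intro!: always_eventually INF_lower coupling)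
qed

end

section \<open>The zero-sum hyperplane\<close>

lemma norm_axis_diff_le: "norm (axis i 1 - axis j 1 :: real ^ 'n) \<le> 2"
  using norm_triangle_ineq4[of "axis i 1 :: real ^ 'n" "axis j 1"] by simp

text \<open>
  Expanding the squares leaves the cross term \<open>2 (\<Sum>i. v\<^sup>i)\<^sup>2\<close>, which vanishes.
\<close>

lemma sum_sq_coordinate_differences:
  fixes v :: "real ^ 'n"
  assumes "v \<in> zero_sum"
  shows "(\<Sum>(i, j)\<in>{(i, j). i \<noteq> j}. (v $ i - v $ j)\<^sup>2) = 2 * real CARD('n) * (norm v)\<^sup>2"
proof -
  have zero: "(\<Sum>i\<in>UNIV. v $ i) = 0" using assms by (simp add: zero_sum_def)
  have norm: "(norm v)\<^sup>2 = (\<Sum>i\<in>UNIV. (v $ i)\<^sup>2)"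
    unfolding power2_norm_eq_inner inner_vec_def by (simp add: power2_eq_square)
  have "(\<Sum>(i, j)\<in>{(i, j). i \<noteq> j}. (v $ i - v $ j)\<^sup>2) = (\<Sum>(i, j)\<in>UNIV \<times> UNIV. (v $ i - v $ j)\<^sup>2)"
    by (rule sum.mono_neutral_left) auto
  also have "\<dots> = (\<Sum>i\<in>UNIV. \<Sum>j\<in>UNIV. (v $ i)\<^sup>2 + (v $ j)\<^sup>2 - 2 * v $ i * v $ j)"
    by (simp only: sum.cartesian_product[symmetric] power2_diff)
  also have "\<dots> = 2 * real CARD('n) * (norm v)\<^sup>2"
    by (simp add: sum.distrib sum_subtractf zero norm flip: sum_distrib_left)
  finally show ?thesis .
qed

lemma closed_zero_sum: "closed (zero_sum :: (real ^ 'n) set)"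
  unfolding zero_sum_def by (intro closed_Collect_eq continuous_intros)

lemma elo_update_in_zero_sum:
  assumes "x \<in> zero_sum"
  shows "elo_update b K x y \<in> zero_sum"
proof -
  obtain i j s where y: "y = ((i, j), s)" by (metis surj_pair)
  have "(\<Sum>k\<in>UNIV. axis l (1 :: real) $ k) = 1" for l :: 'a
    by (simp add: axis_def)
  then show ?thesis
    using assms by (simp add: y zero_sum_def sum.distrib sum_subtractf flip: sum_distrib_left)
qed

section \<open>One step of the Elo chain\<close>

context elo_model
begin

abbreviation G :: "(('n \<times> 'n) \<times> real) measure" where
  "G \<equiv> game_law P S"

abbreviation F :: "real ^ 'n \<Rightarrow> ('n \<times> 'n) \<times> real \<Rightarrow> real ^ 'n" where
  "F \<equiv> elo_update b K"

abbreviation pairs :: "('n \<times> 'n) set" where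
  "pairs \<equiv> {(i, j). i \<noteq> j}"

lemma pairs_nonempty: "pairs \<noteq> {}"
proof
  assume "pairs = {}"
  then have "i = j" for i j :: 'n by auto
  then have "is_singleton (UNIV :: 'n set)" by (metis UNIV_I UNIV_eq_I insertI1 is_singletonI)
  then show False using two_players by (simp add: is_singleton_altdef)
qed

text \<open>
  The kernel inside \<^const>\<open>game_law\<close>. On the diagonal \<open>S i i\<close> need not be measurable, so that
  \<^const>\<open>distr\<close> may return the null measure there; it is in any case a subprobability measure.
\<close>

definition score_law :: "'n \<times> 'n \<Rightarrow> (('n \<times> 'n) \<times> real) measure" where
  "score_law = (\<lambda>(i, j). distr P game_space (\<lambda>\<omega>. ((i, j), S i j \<omega>)))"

lemma score_law_measurable: "score_law \<in> measurable (measure_pmf q) (subprob_algebra game_space)"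
proof -
  have "emeasure (score_law (i, j)) (space (score_law (i, j))) \<le> 1" for i j
    unfolding score_law_def distr_def by (simp add: emeasure_measure_of_conv emeasure_le_1)
  moreover have "sets (score_law y) = sets game_space" "space (score_law y) \<noteq> {}" for y
    by (auto simp: score_law_def split_beta' space_pair_measure)
  ultimately show ?thesis
    by (auto simp: space_subprob_algebra intro!: subprob_spaceI)
qed

lemma sets_game_law[simp, measurable_cong]: "sets G = sets game_space"
  unfolding game_law_def by (rule sets_bind) (auto simp: split_beta')

lemma space_game_law[simp]: "space G = UNIV"
  by (simp add: sets_eq_imp_space_eq[OF sets_game_law] space_pair_measure)

lemma nn_integral_game_law:
  assumes [measurable]: "f \<in> borel_measurable game_space"
  shows "(\<integral>\<^sup>+y. f y \<partial>G) = (\<Sum>(i, j)\<in>pairs. \<integral>\<^sup>+\<omega>. f ((i, j), S i j \<omega>) \<partial>P) / card pairs"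
proof -
  have "(\<integral>\<^sup>+y. f y \<partial>G) = (\<integral>\<^sup>+q. (\<integral>\<^sup>+y. f y \<partial>score_law q) \<partial>measure_pmf (pmf_of_set pairs))"
    unfolding game_law_def score_law_def[symmetric]
    by (rule nn_integral_bind[OF _ score_law_measurable]) simp
  also have "\<dots> = (\<Sum>q\<in>pairs. \<integral>\<^sup>+y. f y \<partial>score_law q) / card pairs"
    by (rule nn_integral_pmf_of_set[OF pairs_nonempty]) simp
  also have "(\<Sum>q\<in>pairs. \<integral>\<^sup>+y. f y \<partial>score_law q) = (\<Sum>(i, j)\<in>pairs. \<integral>\<^sup>+\<omega>. f ((i, j), S i j \<omega>) \<partial>P)"
    using S_measurable
    by (intro sum.cong refl) (auto simp: score_law_def nn_integral_distr)
  finally show ?thesis .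
qed

lemma card_pairs_pos: "0 < card pairs"
  using pairs_nonempty by (simp add: card_gt_0_iff)

text \<open>
  The change of the squared distance in a game depends only on who plays, which reduces its expectation
  to a finite average.
\<close>

lemma nn_integral_game_law_players:
  assumes "\<And>q. q \<in> pairs \<Longrightarrow> 0 \<le> h q"
  shows "(\<integral>\<^sup>+y. ennreal (h (fst y)) \<partial>G) = ennreal ((\<Sum>q\<in>pairs. h q) / card pairs)"
proof -
  have "(\<integral>\<^sup>+y. ennreal (h (fst y)) \<partial>G) = (\<Sum>(i, j)\<in>pairs. ennreal (h (i, j))) / card pairs"
    by (subst nn_integral_game_law) (simp_all add: emeasure_space_1)
  also have "(\<Sum>(i, j)\<in>pairs. ennreal (h (i, j))) = ennreal (\<Sum>q\<in>pairs. h q)"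
    using assms by (subst sum_ennreal[symmetric]) (auto simp: split_beta')
  finally show ?thesis
    using card_pairs_pos assms
    by (subst divide_ennreal[symmetric]) (auto simp: ennreal_of_nat_eq_real_of_nat intro!: sum_nonneg)
qed

sublocale game: prob_space G
proof
  have "real n / real n = 1" if "0 < n" for n :: nat
    using that by simp
  then have "(\<Sum>q\<in>pairs. 1 :: real) / real (card pairs) = 1"
    unfolding sum_constant mult_1_right using card_pairs_pos .
  then have "(\<integral>\<^sup>+y. ennreal 1 \<partial>G) = ennreal 1"
    using nn_integral_game_law_players[of "\<lambda>_. 1"] by (simp only: zero_le_one)
  then show "emeasure G (space G) = 1"
    by simp
qed

lemma AE_score_bounded: "AE y in G. \<bar>snd y\<bar> \<le> 1"
proof -
  have "(\<integral>\<^sup>+y. indicator {y. \<not> \<bar>snd y\<bar> \<le> 1} y \<partial>G) = 0"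
  proof (subst nn_integral_game_law)
    have "(\<integral>\<^sup>+\<omega>. indicator {y. \<not> \<bar>snd y\<bar> \<le> 1} ((i, j), S i j \<omega>) \<partial>P) = 0" if "i \<noteq> j" for i j
    proof -
      have "(\<integral>\<^sup>+\<omega>. indicator {y. \<not> \<bar>snd y\<bar> \<le> 1} ((i, j), S i j \<omega>) \<partial>P) = (\<integral>\<^sup>+\<omega>. 0 \<partial>P)"
      proof (rule nn_integral_cong_AE)
        show "AE \<omega> in P. indicator {y. \<not> \<bar>snd y\<bar> \<le> 1} ((i, j), S i j \<omega>) = (0 :: ennreal)"
          using S_range[OF that] by eventually_elim (auto simp: indicator_def)
      qed
      then show ?thesis by simp
    qed
    then show "(\<Sum>(i, j)\<in>pairs. \<integral>\<^sup>+\<omega>. indicator {y. \<not> \<bar>snd y\<bar> \<le> 1} ((i, j), S i j \<omega>) \<partial>P) / card pairs = 0"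
      by (subst sum.neutral) auto
  qed measurable
  then have "AE y in G. indicator {y. \<not> \<bar>snd y\<bar> \<le> 1} y = (0 :: ennreal)"
    by (subst (asm) nn_integral_0_iff_AE) simp_all
  then show ?thesis
    by eventually_elim (auto simp: indicator_def split: if_splits)
qed

lemma b_diff_bounds:
  assumes "v \<le> u"
  shows "0 \<le> b u - b v" "b u - b v \<le> L * (u - v)"
  using assms strict_mono_less_eq[OF b_strict_mono, of v u] lipschitz_onD[OF b_lipschitz, of u v]
  by (auto simp: dist_real_def)

lemma b_measurable[measurable]: "b \<in> borel_measurable borel"
  using lipschitz_on_continuous_on[OF b_lipschitz] by (rule borel_measurable_continuous_onI)

text \<open>
  The pair of players takes finitely many values, so it is enough to fix it.
\<close>

lemma elo_update_measurable: "(\<lambda>(x, y). F x y) \<in> measurable (borel \<Otimes>\<^sub>M G) borel"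
proof -
  have "(\<lambda>q. fst q + (K * (snd (snd q) - b (fst q $ fst (fst (snd q)) - fst q $ snd (fst (snd q)))))
      *\<^sub>R (axis (fst (fst (snd q))) 1 - axis (snd (fst (snd q))) 1))
    \<in> measurable (borel \<Otimes>\<^sub>M (game_space :: (('n \<times> 'n) \<times> real) measure)) (borel :: (real ^ 'n) measure)"
  proof (rule measurable_compose_countable[where g = "\<lambda>q. fst (snd q)" and
        f = "\<lambda>p q. fst q + (K * (snd (snd q) - b (fst q $ fst p - fst q $ snd p))) *\<^sub>R (axis (fst p) 1 - axis (snd p) 1)"])
    have [measurable]: "(\<lambda>x :: real ^ 'n. x $ i) \<in> borel_measurable borel" for i
      by (intro borel_measurable_continuous_onI continuous_intros)
    show "(\<lambda>q. fst q + (K * (snd (snd q) - b (fst q $ fst p - fst q $ snd p))) *\<^sub>R (axis (fst p) 1 - axis (snd p) 1))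
      \<in> measurable (borel \<Otimes>\<^sub>M (game_space :: (('n \<times> 'n) \<times> real) measure)) (borel :: (real ^ 'n) measure)" for p
      by measurable
  qed measurable
  also have "(\<lambda>q. fst q + (K * (snd (snd q) - b (fst q $ fst (fst (snd q)) - fst q $ snd (fst (snd q)))))
      *\<^sub>R (axis (fst (fst (snd q))) 1 - axis (snd (fst (snd q))) 1)) = (\<lambda>(x, y). F x y)"
    by (auto simp: fun_eq_iff)
  finally show ?thesis
    by (simp cong: measurable_cong_sets)
qed

text \<open>
  The score cancels, and with \<open>D = x - x'\<close>, \<open>\<Delta> = b u - b v\<close> and \<open>e = e\<^sub>i - e\<^sub>j\<close> the new difference
  is \<open>D - K \<Delta> e\<close>. In its squared norm the quadratic term \<open>K\<^sup>2 \<Delta>\<^sup>2 |e|\<^sup>2\<close> is at most \<open>2 K\<^sup>2 L d \<Delta>\<close> by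
  the Lipschitz bound, which leaves the fraction \<open>1 - K L\<close> of the linear term \<open>- 2 K d \<Delta>\<close>.
\<close>

lemma sq_norm_elo_update_diff_le:
  "(norm (F x ((i, j), s) - F x' ((i, j), s)))\<^sup>2 \<le> (norm (x - x'))\<^sup>2
    - 2 * K * (1 - K * L) * ((x $ i - x $ j) - (x' $ i - x' $ j)) * (b (x $ i - x $ j) - b (x' $ i - x' $ j))"
proof -
  define D where "D = x - x'"
  define u v where "u = x $ i - x $ j" and "v = x' $ i - x' $ j"
  define d where "d = u - v"
  define \<Delta> where "\<Delta> = b u - b v"
  define e :: "real ^ 'n" where "e = axis i 1 - axis j 1"
  have De: "D \<bullet> e = d"
    by (simp add: D_def d_def u_def v_def e_def inner_diff_right inner_axis)
  have ee: "e \<bullet> e \<le> 2"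
    by (simp add: e_def inner_diff_left inner_diff_right inner_axis_axis)
  have "F x ((i, j), s) - F x' ((i, j), s) = D - (K * \<Delta>) *\<^sub>R e"
    by (simp add: D_def \<Delta>_def flip: u_def v_def e_def) (simp add: algebra_simps)
  moreover have "(norm (D - c *\<^sub>R e))\<^sup>2 = (norm D)\<^sup>2 - 2 * c * d + c\<^sup>2 * (e \<bullet> e)" for c
    unfolding power2_norm_eq_inner
    by (simp add: inner_diff_left inner_diff_right De inner_commute[of e D] power2_eq_square algebra_simps)
  ultimately have "(norm (F x ((i, j), s) - F x' ((i, j), s)))\<^sup>2
      = (norm D)\<^sup>2 - 2 * (K * \<Delta>) * d + (K * \<Delta>)\<^sup>2 * (e \<bullet> e)"
    by simp
  also have "\<dots> \<le> (norm D)\<^sup>2 - 2 * (K * \<Delta>) * d + (K * \<Delta>)\<^sup>2 * 2"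
    using ee by (intro add_left_mono mult_left_mono) auto
  also have "\<dots> \<le> (norm D)\<^sup>2 - 2 * K * (1 - K * L) * d * \<Delta>"
  proof -
    have "\<Delta>\<^sup>2 \<le> L * d * \<Delta>"
    proof (cases "v \<le> u")
      case True
      then show ?thesis using b_diff_bounds[OF True]
        by (simp add: \<Delta>_def d_def power2_eq_square mult_right_mono)
    next
      case False
      then have "0 \<le> - \<Delta>" "- \<Delta> \<le> L * - d"
        using b_diff_bounds[of u v] by (simp_all add: \<Delta>_def d_def)
      then have "(- \<Delta>) * (- \<Delta>) \<le> (L * - d) * (- \<Delta>)"
        by (intro mult_right_mono)
      then show ?thesis by (simp add: power2_eq_square)
    qed
    then have "2 * K\<^sup>2 * \<Delta>\<^sup>2 \<le> 2 * K\<^sup>2 * (L * d * \<Delta>)"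
      by (intro mult_left_mono) auto
    then show ?thesis by (simp add: algebra_simps power2_eq_square)
  qed
  finally show ?thesis
    by (simp add: D_def d_def \<Delta>_def u_def v_def)
qed

lemma elo_update_nonexpansive: "dist (F x y) (F x' y) \<le> dist x x'"
proof -
  obtain i j s where y: "y = ((i, j), s)" by (metis surj_pair)
  define u v where "u = x $ i - x $ j" and "v = x' $ i - x' $ j"
  have "0 \<le> (u - v) * (b u - b v)"
    using b_diff_bounds(1)[of u v] b_diff_bounds(1)[of v u]
    by (cases "u \<le> v") (auto intro: mult_nonpos_nonpos)
  then have "0 \<le> 2 * K * (1 - K * L) * ((u - v) * (b u - b v))"
    by (rule mult_nonneg_nonneg[rotated]) (use K_pos K_L in simp)
  then have "0 \<le> 2 * K * (1 - K * L) * (u - v) * (b u - b v)"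
    by (simp only: mult.assoc)
  then have "(norm (F x y - F x' y))\<^sup>2 \<le> (norm (x - x'))\<^sup>2"
    using sq_norm_elo_update_diff_le[of x i j s x'] unfolding y u_def v_def by linarith
  then show ?thesis
    unfolding dist_norm by (rule power2_le_imp_le) simp
qed

lemma norm_elo_update_le:
  assumes "\<bar>snd y\<bar> \<le> 1"
  shows "norm (F x y) \<le> norm x + 4 * K"
proof -
  obtain i j s where y: "y = ((i, j), s)" by (metis surj_pair)
  have "\<bar>s - b (x $ i - x $ j)\<bar> \<le> 2"
    using assms b_range[of "x $ i - x $ j"] by (auto simp: y)
  then have "\<bar>K * (s - b (x $ i - x $ j))\<bar> * norm (axis i 1 - axis j 1 :: real ^ 'n) \<le> (K * 2) * 2"
    using K_pos norm_axis_diff_le by (intro mult_mono) (auto simp: abs_mult)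
  then show ?thesis
    using norm_triangle_ineq[of x "(K * (s - b (x $ i - x $ j))) *\<^sub>R (axis i 1 - axis j 1)"]
    by (simp add: y)
qed

section \<open>Contraction and drift of the Elo chain\<close>

text \<open>
  In a ball of radius \<open>R\<close> the differences of coordinates stay in \<open>[- 2 R, 2 R]\<close>, where \<open>b\<close> has slope
  at least \<open>l > 0\<close>. So a game between \<open>i\<close> and \<open>j\<close> removes at least \<open>\<kappa> (D\<^sup>i - D\<^sup>j)\<^sup>2\<close> from the squared
  distance, and on the zero-sum hyperplane the average of this over the pairs is a multiple of
  \<open>|D|\<^sup>2\<close>.
\<close>

lemma local_contraction:
  assumes "0 < R"
  obtains a where "0 \<le> a" "a < 1"
    "\<And>x x'. x \<in> zero_sum \<Longrightarrow> x' \<in> zero_sum \<Longrightarrow> norm x \<le> R \<Longrightarrow> norm x' \<le> R \<Longrightarrow>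
      (\<integral>\<^sup>+y. ennreal ((norm (F x y - F x' y))\<^sup>2) \<partial>G) \<le> ennreal (a * (norm (x - x'))\<^sup>2)"
proof -
  define slopes where "slopes = (\<lambda>(u, v). (b u - b v) / (u - v)) ` {(u, v). - (2 * R) \<le> v \<and> v < u \<and> u \<le> 2 * R}"
  define l where "l = Inf slopes"
  have l: "0 < l"
    using b_slope[of "2 * R"] assms by (simp add: l_def slopes_def)
  have slope: "l * (u - v) \<le> b u - b v" if "- (2 * R) \<le> v" "v < u" "u \<le> 2 * R" for u v
  proof -
    have "bdd_below slopes"
    proof (rule bdd_belowI)
      fix r assume "r \<in> slopes"
      then show "0 \<le> r"
        using b_diff_bounds(1) by (fastforce simp: slopes_def intro!: divide_nonneg_pos)
    qed
    moreover have "(b u - b v) / (u - v) \<in> slopes"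
      using that by (force simp: slopes_def)
    ultimately have "l \<le> (b u - b v) / (u - v)"
      unfolding l_def by (intro cInf_lower)
    then show ?thesis using that by (simp add: field_simps)
  qed
  have slope_sq: "l * (u - v)\<^sup>2 \<le> (u - v) * (b u - b v)" if "\<bar>u\<bar> \<le> 2 * R" "\<bar>v\<bar> \<le> 2 * R" for u v
  proof -
    have wlog: "l * (u - v)\<^sup>2 \<le> (u - v) * (b u - b v)" if "v < u" "\<bar>u\<bar> \<le> 2 * R" "\<bar>v\<bar> \<le> 2 * R" for u v
      using mult_left_mono[OF slope[of v u], of "u - v"] that
      by (simp add: power2_eq_square mult.left_commute)
    show ?thesis
      using wlog[of v u] wlog[of u v] that
      by (cases u v rule: linorder_cases) (auto simp: power2_commute algebra_simps)
  qed
  define n where "n = real (card pairs)"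
  have n: "0 < n" using card_pairs_pos by (simp only: n_def of_nat_0_less_iff)
  define \<kappa> where "\<kappa> = 2 * K * (1 - K * L) * l"
  have \<kappa>: "0 < \<kappa>" using K_pos K_L l by (simp add: \<kappa>_def)
  define c where "c = \<kappa> * (2 * real CARD('n)) / n"
  have c: "0 < c" using \<kappa> n by (simp add: c_def)
  show ?thesis
  proof
    show "0 \<le> max 0 (1 - c)" "max 0 (1 - c) < 1" using c by auto
    fix x x' :: "real ^ 'n"
    assume x: "x \<in> zero_sum" "x' \<in> zero_sum" "norm x \<le> R" "norm x' \<le> R"
    define D where "D = x - x'"
    have D: "D \<in> zero_sum" using x by (simp add: D_def zero_sum_def sum_subtractf)
    define h where "h = (\<lambda>(i, j). (norm D)\<^sup>2 - \<kappa> * (D $ i - D $ j)\<^sup>2)"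
    have h: "(norm (F x y - F x' y))\<^sup>2 \<le> h (fst y)" for y
    proof -
      obtain i j s where y: "y = ((i, j), s)" by (metis surj_pair)
      define u v where "u = x $ i - x $ j" and "v = x' $ i - x' $ j"
      have "\<bar>u\<bar> \<le> 2 * R" "\<bar>v\<bar> \<le> 2 * R"
        using component_le_norm_cart[of x i] component_le_norm_cart[of x j]
          component_le_norm_cart[of x' i] component_le_norm_cart[of x' j] x
        by (auto simp: u_def v_def)
      then have "2 * K * (1 - K * L) * (l * (u - v)\<^sup>2) \<le> 2 * K * (1 - K * L) * ((u - v) * (b u - b v))"
        using K_pos K_L by (intro mult_left_mono slope_sq) auto
      then have "\<kappa> * (u - v)\<^sup>2 \<le> 2 * K * (1 - K * L) * (u - v) * (b u - b v)"
        by (simp only: \<kappa>_def mult.assoc)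
      moreover have "D $ i - D $ j = u - v" by (simp add: D_def u_def v_def)
      moreover have "(norm (F x ((i, j), s) - F x' ((i, j), s)))\<^sup>2
          \<le> (norm D)\<^sup>2 - 2 * K * (1 - K * L) * (u - v) * (b u - b v)"
        using sq_norm_elo_update_diff_le[of x i j s x'] by (simp only: u_def v_def D_def)
      ultimately show ?thesis
        by (simp only: y h_def fst_conv prod.case)
    qed
    have h_nonneg: "0 \<le> h q" for q
      using order_trans[OF zero_le_power2 h[of "(q, 0)"]] by simp
    have "(\<Sum>q\<in>pairs. h q) = n * (norm D)\<^sup>2 - \<kappa> * (\<Sum>(i, j)\<in>pairs. (D $ i - D $ j)\<^sup>2)"
      by (simp only: h_def split_beta' sum_subtractf sum_constant sum_distrib_left n_def)
    also have "\<dots> = n * (norm D)\<^sup>2 - \<kappa> * (2 * real CARD('n) * (norm D)\<^sup>2)"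
      by (simp only: sum_sq_coordinate_differences[OF D])
    also have "\<dots> = n * ((1 - c) * (norm D)\<^sup>2)"
      using n by (simp add: c_def field_simps)
    finally have sum_h: "(\<Sum>q\<in>pairs. h q) / n = (1 - c) * (norm D)\<^sup>2"
      using n by simp
    have "(\<integral>\<^sup>+y. ennreal ((norm (F x y - F x' y))\<^sup>2) \<partial>G) \<le> (\<integral>\<^sup>+y. ennreal (h (fst y)) \<partial>G)"
      by (intro nn_integral_mono ennreal_leI h)
    also have "\<dots> = ennreal ((1 - c) * (norm D)\<^sup>2)"
      using nn_integral_game_law_players[of h] h_nonneg sum_h by (simp only: n_def)
    also have "\<dots> \<le> ennreal (max 0 (1 - c) * (norm (x - x'))\<^sup>2)"
      unfolding D_def by (intro ennreal_leI mult_right_mono) auto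
    finally show "(\<integral>\<^sup>+y. ennreal ((norm (F x y - F x' y))\<^sup>2) \<partial>G)
        \<le> ennreal (max 0 (1 - c) * (norm (x - x'))\<^sup>2)" .
  qed
qed

text \<open>
  A step changes the norm by at most \<open>4 K\<close>, so raising \<open>\<theta>\<^sub>0\<close> by \<open>\<delta>\<close> costs at most the factor
  \<open>exp (4 K \<delta>)\<close>; for small \<open>\<delta>\<close> the product with the old rate \<open>l\<close> is still below one.
\<close>

lemma drift_above_drift_constant:
  assumes "drift_constant P S b K \<theta>\<^sub>0"
  obtains \<theta> l c where "\<theta>\<^sub>0 < \<theta>" "0 < l" "l < 1" "0 \<le> c"
    "\<And>x. x \<in> zero_sum \<Longrightarrow>
      (\<integral>\<^sup>+y. ennreal (exp (\<theta> * norm (F x y))) \<partial>G) \<le> ennreal (l * exp (\<theta> * norm x) + c)"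
proof -
  have \<theta>0: "\<theta>\<^sub>0 \<in> {0<..\<theta>\<^sub>0}"
    using assms by (simp add: drift_constant_def)
  obtain l R c where l: "0 < l" "l < 1" and R: "0 < R" and c: "0 < c"
    and drift: "\<And>x. x \<in> zero_sum \<Longrightarrow> (\<integral>y. exp (\<theta>\<^sub>0 * norm y) \<partial>elo_kernel P S b K x)
      \<le> l * exp (\<theta>\<^sub>0 * norm x) + c * indicator (cball 0 R) x"
    using assms[unfolded drift_constant_def, THEN conjunct2, rule_format, OF \<theta>0] by auto
  have [measurable]: "F x \<in> measurable G borel" for x
    using measurable_compose[OF measurable_Pair[OF measurable_const measurable_ident_sets[OF refl]] elo_update_measurable]
    by simp
  \<comment> \<open>Half of the largest admissible value: the new rate is the square root of \<open>l\<close>.\<close>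
  define \<delta> where "\<delta> = - ln l / (8 * K)"
  have \<delta>: "0 < \<delta>" using l K_pos by (simp add: \<delta>_def divide_neg_pos)
  have "exp (\<delta> * (4 * K)) * l = exp (ln l / 2)"
  proof -
    have "exp (\<delta> * (4 * K)) * l = exp (\<delta> * (4 * K) + ln l)"
      using l by (simp add: exp_add)
    also have "\<delta> * (4 * K) + ln l = ln l / 2"
      using K_pos by (simp add: \<delta>_def field_simps)
    finally show ?thesis .
  qed
  also have "\<dots> < 1" using l by simp
  finally have l': "exp (\<delta> * (4 * K)) * l < 1" .
  define c' where "c' = exp (\<delta> * (4 * K)) * exp (\<delta> * R) * c"
  show ?thesis
  proof
    show "\<theta>\<^sub>0 < \<theta>\<^sub>0 + \<delta>" "0 < exp (\<delta> * (4 * K)) * l" "exp (\<delta> * (4 * K)) * l < 1" "0 \<le> c'"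
      using \<delta> l l' c by (simp_all add: c'_def)
    fix x :: "real ^ 'n" assume x: "x \<in> zero_sum"
    have int: "integrable G (\<lambda>y. exp (\<theta>\<^sub>0 * norm (F x y)))"
    proof (rule game.integrable_const_bound[where B = "exp (\<theta>\<^sub>0 * (norm x + 4 * K))"])
      show "AE y in G. norm (exp (\<theta>\<^sub>0 * norm (F x y))) \<le> exp (\<theta>\<^sub>0 * (norm x + 4 * K))"
        using AE_score_bounded by eventually_elim (use norm_elo_update_le \<theta>0 in \<open>simp add: mult_left_mono\<close>)
    qed simp
    have E0: "(\<integral>\<^sup>+y. ennreal (exp (\<theta>\<^sub>0 * norm (F x y))) \<partial>G)
        \<le> ennreal (l * exp (\<theta>\<^sub>0 * norm x) + c * indicator (cball 0 R) x)"
      using drift[OF x] by (subst nn_integral_eq_integral[OF int]) (simp_all add: elo_kernel_def integral_distr ennreal_leI)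
    have "(\<integral>\<^sup>+y. ennreal (exp ((\<theta>\<^sub>0 + \<delta>) * norm (F x y))) \<partial>G)
        \<le> (\<integral>\<^sup>+y. ennreal (exp (\<delta> * (norm x + 4 * K))) * ennreal (exp (\<theta>\<^sub>0 * norm (F x y))) \<partial>G)"
    proof (rule nn_integral_mono_AE)
      show "AE y in G. ennreal (exp ((\<theta>\<^sub>0 + \<delta>) * norm (F x y)))
          \<le> ennreal (exp (\<delta> * (norm x + 4 * K))) * ennreal (exp (\<theta>\<^sub>0 * norm (F x y)))"
        using AE_score_bounded
      proof eventually_elim
        fix y :: "('n \<times> 'n) \<times> real" assume "\<bar>snd y\<bar> \<le> 1"
        then have "\<delta> * norm (F x y) \<le> \<delta> * (norm x + 4 * K)"
          using \<delta> norm_elo_update_le by (intro mult_left_mono) auto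
        then have "exp ((\<theta>\<^sub>0 + \<delta>) * norm (F x y)) \<le> exp (\<delta> * (norm x + 4 * K)) * exp (\<theta>\<^sub>0 * norm (F x y))"
          unfolding exp_add[symmetric] by (simp add: algebra_simps)
        then show "ennreal (exp ((\<theta>\<^sub>0 + \<delta>) * norm (F x y)))
            \<le> ennreal (exp (\<delta> * (norm x + 4 * K))) * ennreal (exp (\<theta>\<^sub>0 * norm (F x y)))"
          by (simp flip: ennreal_mult add: ennreal_leI)
      qed
    qed
    also have "\<dots> = ennreal (exp (\<delta> * (norm x + 4 * K))) * (\<integral>\<^sup>+y. ennreal (exp (\<theta>\<^sub>0 * norm (F x y))) \<partial>G)"
      by (intro nn_integral_cmult) simp
    also have "\<dots> \<le> ennreal (exp (\<delta> * (norm x + 4 * K)))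
        * ennreal (l * exp (\<theta>\<^sub>0 * norm x) + c * indicator (cball 0 R) x)"
      by (intro mult_left_mono E0) simp
    also have "\<dots> = ennreal (exp (\<delta> * (norm x + 4 * K)) * (l * exp (\<theta>\<^sub>0 * norm x) + c * indicator (cball 0 R) x))"
      using l c by (intro ennreal_mult[symmetric]) auto
    also have "\<dots> \<le> ennreal (exp (\<delta> * (4 * K)) * l * exp ((\<theta>\<^sub>0 + \<delta>) * norm x) + c')"
    proof (rule ennreal_leI)
      have "exp (\<delta> * norm x) * (c * indicator (cball 0 R) x) \<le> exp (\<delta> * R) * c"
        using \<delta> c by (auto simp: indicator_def)
      from mult_left_mono[OF this, of "exp (\<delta> * (4 * K))"]
      show "exp (\<delta> * (norm x + 4 * K)) * (l * exp (\<theta>\<^sub>0 * norm x) + c * indicator (cball 0 R) x)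
          \<le> exp (\<delta> * (4 * K)) * l * exp ((\<theta>\<^sub>0 + \<delta>) * norm x) + c'"
        by (simp add: c'_def exp_add distrib_left distrib_right mult_ac)
    qed
    finally show "(\<integral>\<^sup>+y. ennreal (exp ((\<theta>\<^sub>0 + \<delta>) * norm (F x y))) \<partial>G)
        \<le> ennreal (exp (\<delta> * (4 * K)) * l * exp ((\<theta>\<^sub>0 + \<delta>) * norm x) + c')" .
  qed
qed

definition weighted_dist :: "real \<Rightarrow> real \<Rightarrow> real ^ 'n \<Rightarrow> real ^ 'n \<Rightarrow> real" where
  "weighted_dist \<theta> \<beta> x x' = norm (x - x') * sqrt (1 + \<beta> * (exp (\<theta> * norm x) + exp (\<theta> * norm x')))"

text \<open>
  Let \<open>T\<close> be the sum of the weights at \<open>x\<close> and \<open>x'\<close>. In a large ball the squared distance contracts by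
  \<open>a < 1\<close> while \<open>1 + \<beta> T\<close> grows by at most \<open>1 + 2 \<beta> c\<close>, which a small \<open>\<beta>\<close> makes harmless. If one
  point lies outside, \<open>T\<close> is so large that the drift absorbs the constant \<open>2 c\<close>, and \<open>1 + \<beta> T\<close>
  contracts by \<open>q < 1\<close> while the distance does not grow.
\<close>

lemma weighted_contraction:
  assumes "0 < \<theta>" "0 < l" "l < 1" "0 \<le> c"
    and drift: "\<And>x. x \<in> zero_sum \<Longrightarrow>
      (\<integral>\<^sup>+y. ennreal (exp (\<theta> * norm (F x y))) \<partial>G) \<le> ennreal (l * exp (\<theta> * norm x) + c)"
  obtains \<alpha> \<beta> where "0 \<le> \<alpha>" "\<alpha> < 1" "0 < \<beta>"
    "\<And>x x'. x \<in> zero_sum \<Longrightarrow> x' \<in> zero_sum \<Longrightarrow>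
      (\<integral>\<^sup>+y. ennreal (weighted_dist \<theta> \<beta> (F x y) (F x' y)) \<partial>G) \<le> ennreal \<alpha> * ennreal (weighted_dist \<theta> \<beta> x x')"
proof -
  have [measurable]: "F x \<in> measurable G borel" for x
    using measurable_compose[OF measurable_Pair[OF measurable_const measurable_ident_sets[OF refl]] elo_update_measurable]
    by simp
  \<comment> \<open>Outside the ball of radius \<open>R\<close> the sum of weights exceeds \<open>4 c / (1 - l)\<close>.\<close>
  define R where "R = (1 + 4 * c / (1 - l)) / \<theta>"
  have R: "0 < R" using assms by (simp add: R_def add_pos_nonneg)
  define T0 where "T0 = exp (\<theta> * R)"
  have "4 * c / (1 - l) \<le> T0"
    using exp_ge_add_one_self[of "\<theta> * R"] \<open>0 < \<theta>\<close> by (simp add: T0_def R_def)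
  then have T0: "4 * c \<le> (1 - l) * T0" "0 < T0"
    using \<open>l < 1\<close> by (simp_all add: field_simps T0_def)
  obtain a where a: "0 \<le> a" "a < 1"
    and local: "\<And>x x'. x \<in> zero_sum \<Longrightarrow> x' \<in> zero_sum \<Longrightarrow> norm x \<le> R \<Longrightarrow> norm x' \<le> R \<Longrightarrow>
      (\<integral>\<^sup>+y. ennreal ((norm (F x y - F x' y))\<^sup>2) \<partial>G) \<le> ennreal (a * (norm (x - x'))\<^sup>2)"
    using local_contraction[OF R] by blast
  \<comment> \<open>With this \<open>\<beta>\<close> the mean of \<open>a\<close> and \<open>1 + 2 \<beta> c\<close> is at most \<open>(3 + a) / 4\<close>.\<close>
  define \<beta> where "\<beta> = (1 - a) / (4 * (c + 1))"
  have \<beta>: "0 < \<beta>" "2 * \<beta> * c \<le> (1 - a) / 2"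
    using a \<open>0 \<le> c\<close> by (simp_all add: \<beta>_def field_simps)
  define l' where "l' = (1 + l) / 2"
  have l': "0 < l'" "l' < 1" using \<open>0 < l\<close> \<open>l < 1\<close> by (simp_all add: l'_def)
  define q where "q = (1 + \<beta> * l' * T0) / (1 + \<beta> * T0)"
  have q: "0 < q" "q < 1"
    using \<beta> l' T0 by (simp_all add: q_def add_pos_pos field_simps)
  define \<alpha> where "\<alpha> = max ((3 + a) / 4) ((1 + q) / 2)"
  show ?thesis
  proof
    show "0 \<le> \<alpha>" "\<alpha> < 1" "0 < \<beta>"
      using a q \<beta> by (auto simp: \<alpha>_def le_max_iff_disj)
    fix x x' :: "real ^ 'n" assume x: "x \<in> zero_sum" "x' \<in> zero_sum"
    define T where "T = exp (\<theta> * norm x) + exp (\<theta> * norm x')"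
    define T' where "T' y = exp (\<theta> * norm (F x y)) + exp (\<theta> * norm (F x' y))" for y
    have T: "0 < T" "\<And>y. 0 < T' y" by (simp_all add: T_def T'_def add_pos_pos)
    have step: "(\<integral>\<^sup>+y. ennreal (weighted_dist \<theta> \<beta> (F x y) (F x' y)) \<partial>G)
        \<le> ennreal ((p + r) / 2 * (norm (x - x') * sqrt (1 + \<beta> * T)))"
      if "x \<noteq> x'" "0 \<le> p" "0 \<le> r"
        and p: "(\<integral>\<^sup>+y. ennreal ((norm (F x y - F x' y))\<^sup>2) \<partial>G) \<le> ennreal (p * (norm (x - x'))\<^sup>2)"
        and r: "1 + \<beta> * (l * T + 2 * c) \<le> r * (1 + \<beta> * T)" for p r
      unfolding weighted_dist_def T'_def[symmetric]
    proof (rule nn_integral_mult_sqrt_le)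
      have "(\<integral>\<^sup>+y. ennreal (1 + \<beta> * T' y) \<partial>G)
          = (\<integral>\<^sup>+y. 1 + ennreal \<beta> * (ennreal (exp (\<theta> * norm (F x y))) + ennreal (exp (\<theta> * norm (F x' y)))) \<partial>G)"
        using \<beta> T(2) by (intro nn_integral_cong) (simp add: T'_def ennreal_plus ennreal_mult add_nonneg_nonneg)
      also have "\<dots> = 1 + ennreal \<beta> * ((\<integral>\<^sup>+y. ennreal (exp (\<theta> * norm (F x y))) \<partial>G)
          + (\<integral>\<^sup>+y. ennreal (exp (\<theta> * norm (F x' y))) \<partial>G))"
        by (simp add: nn_integral_add nn_integral_cmult game.emeasure_space_1[simplified])
      also have "\<dots> \<le> 1 + ennreal \<beta> * (ennreal (l * exp (\<theta> * norm x) + c) + ennreal (l * exp (\<theta> * norm x') + c))"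
        by (intro add_left_mono mult_left_mono add_mono drift x) simp
      also have "\<dots> = ennreal (1 + \<beta> * (l * T + 2 * c))"
        using \<beta> \<open>0 < l\<close> \<open>0 \<le> c\<close>
        by (simp add: T_def algebra_simps flip: ennreal_plus ennreal_mult ennreal_1)
      also have "\<dots> \<le> ennreal (r * (1 + \<beta> * T))"
        by (rule ennreal_leI[OF r])
      finally show "(\<integral>\<^sup>+y. ennreal (1 + \<beta> * T' y) \<partial>G) \<le> ennreal (r * (1 + \<beta> * T))" .
    qed (use that T \<beta> p in \<open>auto simp: T'_def add_nonneg_nonneg add_pos_nonneg\<close>)
    have "(\<integral>\<^sup>+y. ennreal (weighted_dist \<theta> \<beta> (F x y) (F x' y)) \<partial>G)
        \<le> ennreal (\<alpha> * (norm (x - x') * sqrt (1 + \<beta> * T)))"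
    proof (cases "x = x'")
      case True
      then show ?thesis by (simp add: weighted_dist_def)
    next
      case neq: False
      show ?thesis
      proof (cases "norm x \<le> R \<and> norm x' \<le> R")
        case True
        have "1 + \<beta> * (l * T + 2 * c) \<le> (1 + 2 * \<beta> * c) * (1 + \<beta> * T)"
        proof -
          have "\<beta> * (l * T) \<le> \<beta> * T" using \<beta> T \<open>l < 1\<close> by simp
          moreover have "0 \<le> 2 * \<beta> * c * (\<beta> * T)" using \<beta> T \<open>0 \<le> c\<close> by simp
          ultimately show ?thesis by (simp add: algebra_simps)
        qed
        then have "(\<integral>\<^sup>+y. ennreal (weighted_dist \<theta> \<beta> (F x y) (F x' y)) \<partial>G)
            \<le> ennreal ((a + (1 + 2 * \<beta> * c)) / 2 * (norm (x - x') * sqrt (1 + \<beta> * T)))"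
          using neq a \<beta> \<open>0 \<le> c\<close> True by (intro step local x) auto
        also have "\<dots> \<le> ennreal (\<alpha> * (norm (x - x') * sqrt (1 + \<beta> * T)))"
        proof (intro ennreal_leI mult_right_mono)
          show "(a + (1 + 2 * \<beta> * c)) / 2 \<le> \<alpha>"
            unfolding \<alpha>_def using \<beta>(2) by (intro max.coboundedI1) argo
        qed (use \<beta> T in auto)
        finally show ?thesis .
      next
        case False
        then have "T0 \<le> exp (\<theta> * norm x) \<or> T0 \<le> exp (\<theta> * norm x')"
          using \<open>0 < \<theta>\<close> by (auto simp: T0_def)
        then have TT: "T0 \<le> T"
          unfolding T_def by (smt (verit) exp_gt_zero)
        then have "4 * c \<le> (1 - l) * T"
          using T0 \<open>l < 1\<close> by (smt (verit) mult_left_mono)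
        then have "l * T + 2 * c \<le> l' * T"
          by (simp add: l'_def field_simps)
        then have "1 + \<beta> * (l * T + 2 * c) \<le> 1 + \<beta> * (l' * T)"
          using \<beta> by simp
        also have "\<dots> \<le> q * (1 + \<beta> * T)"
        proof -
          have "0 \<le> \<beta> * ((1 - l') * (T - T0))"
            using \<beta> l' TT by simp
          then have "(1 + \<beta> * (l' * T)) * (1 + \<beta> * T0) \<le> (1 + \<beta> * l' * T0) * (1 + \<beta> * T)"
            by (simp add: algebra_simps)
          then show ?thesis
            using \<beta> T0 by (simp add: q_def add_pos_pos pos_le_divide_eq)
        qed
        finally have r: "1 + \<beta> * (l * T + 2 * c) \<le> q * (1 + \<beta> * T)" .
        have "(norm (F x y - F x' y))\<^sup>2 \<le> (norm (x - x'))\<^sup>2" for y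
          using elo_update_nonexpansive[of x y x'] by (simp add: dist_norm power_mono)
        then have "(\<integral>\<^sup>+y. ennreal ((norm (F x y - F x' y))\<^sup>2) \<partial>G) \<le> (\<integral>\<^sup>+y. ennreal ((norm (x - x'))\<^sup>2) \<partial>G)"
          by (intro nn_integral_mono ennreal_leI)
        also have "\<dots> = ennreal (1 * (norm (x - x'))\<^sup>2)"
          by (simp add: game.emeasure_space_1[simplified])
        finally have "(\<integral>\<^sup>+y. ennreal (weighted_dist \<theta> \<beta> (F x y) (F x' y)) \<partial>G)
            \<le> ennreal ((1 + q) / 2 * (norm (x - x') * sqrt (1 + \<beta> * T)))"
          using neq q by (intro step r) auto
        also have "\<dots> \<le> ennreal (\<alpha> * (norm (x - x') * sqrt (1 + \<beta> * T)))"
          using \<beta> T by (intro ennreal_leI mult_right_mono) (auto simp: \<alpha>_def)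
        finally show ?thesis .
      qed
    qed
    also have "\<dots> = ennreal \<alpha> * ennreal (weighted_dist \<theta> \<beta> x x')"
      using \<open>0 \<le> \<alpha>\<close> \<beta> T by (subst ennreal_mult) (auto simp: weighted_dist_def T_def)
    finally show "(\<integral>\<^sup>+y. ennreal (weighted_dist \<theta> \<beta> (F x y) (F x' y)) \<partial>G)
        \<le> ennreal \<alpha> * ennreal (weighted_dist \<theta> \<beta> x x')" .
  qed
qed

section \<open>The stationary law and the convergence to it\<close>

text \<open>
  The current state is a function of the history, hence independent of the current game. So the pair
  has a product law, and the update turns it into one step of the kernel.
\<close>

lemma elo_process_step:
  assumes proc: "elo_process P S b K M X Y"
  shows "distr M borel (X (Suc t)) = distr M borel (X t) \<bind> elo_kernel P S b K"
proof -
  interpret M: prob_space M using proc by (simp add: elo_process_def)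
  have [measurable]: "X t \<in> borel_measurable M" "Y t \<in> measurable M game_space" for t
    using proc by (auto simp: elo_process_def)
  have law_Y: "distr M game_space (Y t) = G"
    using proc by (simp add: elo_process_def)
  have step: "X (Suc t) \<omega> = F (X t \<omega>) (Y t \<omega>)" if "\<omega> \<in> space M" for \<omega>
    using proc that by (simp add: elo_process_def)
  let ?past = "Pi\<^sub>M {..t} (\<lambda>_. borel) \<Otimes>\<^sub>M Pi\<^sub>M {..<t} (\<lambda>_. game_space) :: ((nat \<Rightarrow> real ^ 'n) \<times> (nat \<Rightarrow> ('n \<times> 'n) \<times> real)) measure"
  let ?history = "\<lambda>\<omega>. (\<lambda>s\<in>{..t}. X s \<omega>, \<lambda>s\<in>{..<t}. Y s \<omega>)"
  have indep: "M.indep_set (sets (vimage_algebra (space M) ?history ?past))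
      (sets (vimage_algebra (space M) (Y t) game_space))"
    using proc by (simp add: elo_process_def)
  have history_space: "?history \<in> space M \<rightarrow> space ?past"
    by (auto simp: space_pair_measure space_PiM)
  have current: "(\<lambda>h. fst h t) \<in> measurable ?past (borel :: (real ^ 'n) measure)"
    by measurable
  have past_event: "X t -` A \<inter> space M \<in> sets (vimage_algebra (space M) ?history ?past)"
    if "A \<in> sets borel" for A
    using measurable_sets[OF measurable_compose[OF measurable_vimage_algebra1[OF history_space] current] that]
    by simp
  have joint: "distr M borel (X t) \<Otimes>\<^sub>M G = distr M (borel \<Otimes>\<^sub>M game_space) (\<lambda>\<omega>. (X t \<omega>, Y t \<omega>))"
  proof (rule pair_measure_eqI)
    have "prob_space (distr M borel (X t))"
      by (rule M.prob_space_distr) simp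
    then show "sigma_finite_measure (distr M borel (X t))"
      by (rule prob_space_imp_sigma_finite)
    show "sigma_finite_measure G" ..
    show "sets (distr M borel (X t) \<Otimes>\<^sub>M G) = sets (distr M (borel \<Otimes>\<^sub>M game_space) (\<lambda>\<omega>. (X t \<omega>, Y t \<omega>)))"
      by (simp cong: sets_pair_measure_cong)
    fix A B assume "A \<in> sets (distr M borel (X t))" and "B \<in> sets G"
    then have [measurable]: "A \<in> sets borel" "B \<in> sets game_space" by simp_all
    have "Y t -` B \<inter> space M \<in> sets (vimage_algebra (space M) (Y t) game_space)"
      by (rule in_vimage_algebra) simp
    from M.indep_setD[OF indep past_event this]
    have "M.prob ((X t -` A \<inter> space M) \<inter> (Y t -` B \<inter> space M))
        = M.prob (X t -` A \<inter> space M) * M.prob (Y t -` B \<inter> space M)"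
      by simp
    moreover have "(\<lambda>\<omega>. (X t \<omega>, Y t \<omega>)) -` (A \<times> B) \<inter> space M = (X t -` A \<inter> space M) \<inter> (Y t -` B \<inter> space M)"
      by auto
    ultimately show "emeasure (distr M borel (X t)) A * emeasure G B
        = emeasure (distr M (borel \<Otimes>\<^sub>M game_space) (\<lambda>\<omega>. (X t \<omega>, Y t \<omega>))) (A \<times> B)"
      by (simp add: emeasure_distr M.emeasure_eq_measure ennreal_mult flip: law_Y)
  qed
  have kernel: "elo_kernel P S b K \<in> measurable (distr M borel (X t)) (subprob_algebra borel)"
  proof -
    have "elo_kernel P S b K \<in> measurable borel (subprob_algebra borel)"
      unfolding elo_kernel_def[abs_def]
      by (rule measurable_distr2[OF elo_update_measurable])
        (auto simp: space_subprob_algebra intro!: measurable_const prob_space_imp_subprob_space game.prob_space_axioms)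
    then show ?thesis by simp
  qed
  show ?thesis
  proof (rule measure_eqI_nn_integral)
    show "sets (distr M borel (X (Suc t))) = sets (distr M borel (X t) \<bind> elo_kernel P S b K)"
      by (subst sets_bind) (auto simp: elo_kernel_def)
    fix f :: "real ^ 'n \<Rightarrow> ennreal" assume "f \<in> borel_measurable (distr M borel (X (Suc t)))"
    then have [measurable]: "f \<in> borel_measurable borel" by simp
    have fF: "(\<lambda>q. f (case q of (x, y) \<Rightarrow> F x y)) \<in> borel_measurable (borel \<Otimes>\<^sub>M G)"
      by (rule measurable_compose[OF elo_update_measurable]) simp
    then have fF': "(\<lambda>q. f (case q of (x, y) \<Rightarrow> F x y)) \<in> borel_measurable (borel \<Otimes>\<^sub>M game_space)"
      by (simp cong: measurable_cong_sets)
    have Fx: "F x \<in> measurable G borel" for x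
      using measurable_Pair2[OF elo_update_measurable, of x] by simp
    have "(\<integral>\<^sup>+x. f x \<partial>distr M borel (X (Suc t))) = (\<integral>\<^sup>+\<omega>. f (F (X t \<omega>) (Y t \<omega>)) \<partial>M)"
      by (subst nn_integral_distr) (auto simp: step intro!: nn_integral_cong)
    also have "\<dots> = (\<integral>\<^sup>+q. f (case q of (x, y) \<Rightarrow> F x y) \<partial>(distr M borel (X t) \<Otimes>\<^sub>M G))"
      unfolding joint by (subst nn_integral_distr) (auto intro: fF')
    also have "\<dots> = (\<integral>\<^sup>+x. (\<integral>\<^sup>+y. f (F x y) \<partial>G) \<partial>distr M borel (X t))"
      using fF by (subst game.nn_integral_fst[symmetric]) (simp_all cong: measurable_cong_sets)
    also have "\<dots> = (\<integral>\<^sup>+x. f x \<partial>(distr M borel (X t) \<bind> elo_kernel P S b K))"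
      using Fx by (subst nn_integral_bind[OF _ kernel]) (simp_all add: elo_kernel_def nn_integral_distr)
    finally show "(\<integral>\<^sup>+x. f x \<partial>distr M borel (X (Suc t)))
        = (\<integral>\<^sup>+x. f x \<partial>(distr M borel (X t) \<bind> elo_kernel P S b K))" .
  qed
qed

lemma elo_is_contractive_ifs:
  assumes "drift_constant P S b K \<theta>\<^sub>0"
  obtains H \<alpha> \<theta> where "contractive_ifs G F zero_sum H \<alpha> 0" "\<theta>\<^sub>0 < \<theta>"
    "(\<integral>\<^sup>+x. ennreal (exp (\<theta> * norm x)) \<partial>contractive_ifs.limit_law G F 0) < \<top>"
proof -
  obtain \<theta> l c where \<theta>: "\<theta>\<^sub>0 < \<theta>" and l: "0 < l" "l < 1" and c: "0 \<le> c"
    and drift: "\<And>x. x \<in> zero_sum \<Longrightarrow>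
      (\<integral>\<^sup>+y. ennreal (exp (\<theta> * norm (F x y))) \<partial>G) \<le> ennreal (l * exp (\<theta> * norm x) + c)"
    using drift_above_drift_constant[OF assms] by blast
  have "0 < \<theta>" using \<theta> assms by (simp add: drift_constant_def)
  obtain \<alpha> \<beta> where \<alpha>: "0 \<le> \<alpha>" "\<alpha> < 1" and \<beta>: "0 < \<beta>"
    and contraction: "\<And>x x'. x \<in> zero_sum \<Longrightarrow> x' \<in> zero_sum \<Longrightarrow>
      (\<integral>\<^sup>+y. ennreal (weighted_dist \<theta> \<beta> (F x y) (F x' y)) \<partial>G) \<le> ennreal \<alpha> * ennreal (weighted_dist \<theta> \<beta> x x')"
    using weighted_contraction[OF \<open>0 < \<theta>\<close> l c drift] by blast
  have "contractive_ifs G F zero_sum (weighted_dist \<theta> \<beta>) \<alpha> 0"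
  proof
    show "(\<lambda>(x, y). F x y) \<in> measurable (borel \<Otimes>\<^sub>M G) borel" by (rule elo_update_measurable)
    show "dist (F x y) (F x' y) \<le> dist x x'" for x x' y by (rule elo_update_nonexpansive)
    show "closed (zero_sum :: (real ^ 'n) set)" by (rule closed_zero_sum)
    show "F x y \<in> zero_sum" if "x \<in> zero_sum" for x y using that by (rule elo_update_in_zero_sum)
    show "(0 :: real ^ 'n) \<in> zero_sum" by (simp add: zero_sum_def)
    show "(\<lambda>(x, x'). weighted_dist \<theta> \<beta> x x') \<in> borel_measurable (borel \<Otimes>\<^sub>M borel)"
      unfolding weighted_dist_def by measurable
    show "dist x x' \<le> weighted_dist \<theta> \<beta> x x'" for x x'
      using mult_left_mono[of 1 "sqrt (1 + \<beta> * (exp (\<theta> * norm x) + exp (\<theta> * norm x')))" "norm (x - x')"] \<beta>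
      by (simp add: weighted_dist_def dist_norm)
    have "(\<integral>\<^sup>+y. ennreal (weighted_dist \<theta> \<beta> (F 0 y) 0) \<partial>G)
        \<le> (\<integral>\<^sup>+y. ennreal (4 * K * sqrt (1 + \<beta> * (exp (\<theta> * (4 * K)) + 1))) \<partial>G)"
    proof (rule nn_integral_mono_AE)
      show "AE y in G. ennreal (weighted_dist \<theta> \<beta> (F 0 y) 0)
          \<le> ennreal (4 * K * sqrt (1 + \<beta> * (exp (\<theta> * (4 * K)) + 1)))"
        using AE_score_bounded
      proof eventually_elim
        fix y :: "('n \<times> 'n) \<times> real" assume "\<bar>snd y\<bar> \<le> 1"
        from norm_elo_update_le[OF this, of 0] have "norm (F 0 y) \<le> 4 * K" by simp
        then show "ennreal (weighted_dist \<theta> \<beta> (F 0 y) 0)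
            \<le> ennreal (4 * K * sqrt (1 + \<beta> * (exp (\<theta> * (4 * K)) + 1)))"
          unfolding weighted_dist_def using \<beta> \<open>0 < \<theta>\<close> K_pos
          by (intro ennreal_leI mult_mono real_sqrt_le_mono add_left_mono add_mono mult_left_mono) auto
      qed
    qed
    also have "\<dots> < \<top>" by (simp add: game.emeasure_space_1[simplified])
    finally show "(\<integral>\<^sup>+y. ennreal (weighted_dist \<theta> \<beta> (F 0 y) 0) \<partial>G) < \<top>" .
  qed (use \<alpha> contraction in auto)
  then interpret ifs: contractive_ifs G F zero_sum "weighted_dist \<theta> \<beta>" \<alpha> 0 .
  have "(\<integral>\<^sup>+x. ennreal (exp (\<theta> * norm x)) \<partial>ifs.limit_law) \<le> ennreal (exp (\<theta> * norm (0 :: real ^ 'n)) + c / (1 - l))"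
    using l c drift by (intro ifs.nn_integral_limit_law_le[where V = "\<lambda>x. exp (\<theta> * norm x)"] continuous_intros) auto
  then have "(\<integral>\<^sup>+x. ennreal (exp (\<theta> * norm x)) \<partial>ifs.limit_law) < \<top>"
    by (rule le_less_trans) simp
  with that ifs.contractive_ifs_axioms \<theta> show ?thesis by blast
qed

end

theorem theorem13:
  fixes P :: "'s measure"
    and S :: "'n::finite \<Rightarrow> 'n \<Rightarrow> 's \<Rightarrow> real"
    and \<rho> :: "real ^ 'n"
    and b :: "real \<Rightarrow> real"
    and L K \<theta>\<^sub>0 :: real
  assumes "elo_model P S \<rho> b L K"
    and "drift_constant P S b K \<theta>\<^sub>0"
  shows "(\<exists>!\<pi>. elo_stationary P S b K \<pi>) \<and>
    (\<forall>\<pi>. elo_stationary P S b K \<pi> \<longrightarrow>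
      (\<forall>p\<ge>0. integrable \<pi> (\<lambda>x. norm x powr p * exp (\<theta>\<^sub>0 * norm x))) \<and>
      (\<forall>(M :: 'w measure) X Y. elo_process P S b K M X Y \<longrightarrow>
        converges_weakly (\<lambda>t. distr M borel (X t)) \<pi>) \<and>
      (\<forall>(M :: 'w measure) X Y. \<forall>p\<ge>1. elo_process P S b K M X Y \<longrightarrow>
        integrable M (\<lambda>\<omega>. norm (X 0 \<omega>) powr p) \<longrightarrow>
        (\<lambda>t. wasserstein p (distr M borel (X t)) \<pi>) \<longlonglongrightarrow> 0))"
proof -
  interpret elo_model P S \<rho> b L K by fact
  obtain H \<alpha> \<theta> where "contractive_ifs G F zero_sum H \<alpha> 0" and \<theta>: "\<theta>\<^sub>0 < \<theta>"
    and exp_moment: "(\<integral>\<^sup>+x. ennreal (exp (\<theta> * norm x)) \<partial>contractive_ifs.limit_law G F 0) < \<top>"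
    using elo_is_contractive_ifs[OF assms(2)] by blast
  then interpret ifs: contractive_ifs G F zero_sum H \<alpha> 0 by simp
  have "0 < \<theta>\<^sub>0" using assms(2) by (simp add: drift_constant_def)
  have kernel_eq: "elo_kernel P S b K = ifs.kernel"
    by (simp add: fun_eq_iff elo_kernel_def ifs.kernel_def)
  have stationary: "elo_stationary P S b K ifs.limit_law"
    by (simp add: elo_stationary_def kernel_eq ifs.prob_space_limit_law ifs.AE_limit_law_in_C
        ifs.limit_law_stationary)
  have unique: "\<pi> = ifs.limit_law" if "elo_stationary P S b K \<pi>" for \<pi>
    using that by (intro ifs.stationary_eq_limit_law) (auto simp: elo_stationary_def kernel_eq)
  have moments: "integrable ifs.limit_law (\<lambda>x. norm x powr p * exp (\<theta>\<^sub>0 * norm x))" if "0 \<le> p" for p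
  proof -
    obtain A where A: "0 \<le> A" "\<And>u. 0 \<le> u \<Longrightarrow> u powr p \<le> A * exp ((\<theta> - \<theta>\<^sub>0) * u)"
      by (rule powr_le_const_mult_exp[of p "\<theta> - \<theta>\<^sub>0"]) (use \<open>0 \<le> p\<close> \<theta> in auto)
    have "integrable ifs.limit_law (\<lambda>x. exp (\<theta> * norm x))"
      using exp_moment by (intro integrableI_bounded) (auto simp: )
    then have "integrable ifs.limit_law (\<lambda>x. A * exp (\<theta> * norm x))"
      by simp
    then show ?thesis
    proof (rule Bochner_Integration.integrable_bound)
      have "norm x powr p * exp (\<theta>\<^sub>0 * norm x) \<le> A * exp (\<theta> * norm x)" for x :: "real ^ 'n"
      proof -
        have "norm x powr p * exp (\<theta>\<^sub>0 * norm x) \<le> A * exp ((\<theta> - \<theta>\<^sub>0) * norm x) * exp (\<theta>\<^sub>0 * norm x)"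
          using A(2)[of "norm x"] by (intro mult_right_mono) auto
        also have "\<dots> = A * exp (\<theta> * norm x)"
          by (simp add: mult.assoc flip: exp_add) (simp add: algebra_simps)
        finally show ?thesis .
      qed
      then show "AE x in ifs.limit_law. norm (norm x powr p * exp (\<theta>\<^sub>0 * norm x)) \<le> norm (A * exp (\<theta> * norm x))"
        using A(1) by simp
    qed simp
  qed
  have initial: "prob_space (distr M borel (X 0))" "AE x in distr M borel (X 0). x \<in> zero_sum"
    if "elo_process P S b K M X Y" for M :: "'w measure" and X Y
  proof -
    have M: "prob_space M" "X 0 \<in> borel_measurable M" "AE \<omega> in M. X 0 \<omega> \<in> zero_sum"
      using that by (simp_all add: elo_process_def)
    show "prob_space (distr M borel (X 0))"
      using M(1,2) by (rule prob_space.prob_space_distr)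
    show "AE x in distr M borel (X 0). x \<in> zero_sum"
    proof (subst AE_distr_iff[OF M(2)])
      show "{x \<in> space borel. x \<in> zero_sum} \<in> sets (borel :: (real ^ 'n) measure)"
        using borel_closed[OF closed_zero_sum] by simp
    qed (rule M(3))
  qed
  have law_X: "distr M borel (X t) = ifs.law (distr M borel (X 0)) t"
    if "elo_process P S b K M X Y" for M :: "'w measure" and X Y t
    using initial(1)[OF that]
    by (induction t) (simp_all add: ifs.law_0 ifs.law_Suc elo_process_step[OF that] kernel_eq)
  have weak: "converges_weakly (\<lambda>t. distr M borel (X t)) ifs.limit_law"
    if "elo_process P S b K M X Y" for M :: "'w measure" and X Y
  proof -
    have "(\<lambda>t. distr M borel (X t)) = ifs.law (distr M borel (X 0))"
      by (rule ext) (rule law_X[OF that])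
    then show ?thesis
      using ifs.law_converges_weakly[OF initial(1)[OF that] _ initial(2)[OF that]] by simp
  qed
  have wasserstein: "(\<lambda>t. wasserstein p (distr M borel (X t)) ifs.limit_law) \<longlonglongrightarrow> 0"
    if proc: "elo_process P S b K M X Y" and "1 \<le> p"
      and int: "integrable M (\<lambda>\<omega>. norm (X 0 \<omega>) powr p)" for M :: "'w measure" and X Y p
  proof -
    have X0: "X 0 \<in> borel_measurable M" using proc by (simp add: elo_process_def)
    have "(\<integral>\<^sup>+x. ennreal (norm x powr p) \<partial>distr M borel (X 0)) < \<top>"
      using int X0 by (subst nn_integral_distr) (simp_all add: integrable_iff_bounded)
    moreover have "(\<integral>\<^sup>+x. ennreal (norm x powr p) \<partial>ifs.limit_law) < \<top>"
    proof -
      have "(\<integral>\<^sup>+x. ennreal (norm x powr p) \<partial>ifs.limit_law)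
          \<le> (\<integral>\<^sup>+x. ennreal (norm (norm x powr p * exp (\<theta>\<^sub>0 * norm x))) \<partial>ifs.limit_law)"
        using \<open>0 < \<theta>\<^sub>0\<close> by (intro nn_integral_mono ennreal_leI) (simp add: mult_le_cancel_left1)
      also have "\<dots> < \<top>"
        using moments[of p] \<open>1 \<le> p\<close> by (simp add: integrable_iff_bounded)
      finally show ?thesis .
    qed
    ultimately have "(\<lambda>t. wasserstein p (ifs.law (distr M borel (X 0)) t) (ifs.law ifs.limit_law t)) \<longlonglongrightarrow> 0"
      using \<open>1 \<le> p\<close> initial[OF proc]
      by (intro ifs.law_wasserstein_tendsto_0)
        (auto simp: ifs.prob_space_limit_law ifs.AE_limit_law_in_C)
    then show ?thesis
      by (simp add: law_X[OF proc, symmetric] ifs.law_stationary ifs.prob_space_limit_law ifs.limit_law_stationary)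
  qed
  have "\<exists>!\<pi>. elo_stationary P S b K \<pi>"
    using stationary unique by blast
  moreover have "\<pi> = ifs.limit_law" if "elo_stationary P S b K \<pi>" for \<pi>
    using that by (rule unique)
  ultimately show ?thesis
    using moments weak wasserstein by blast
qed

end
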